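(* Let $G$ be a compact group and $g_0\in G$. For every $\rho\in\widehat{G}$ fix a unitary representation $(T^\rho,V^\rho)$ in the class $\rho$ and an orthonormal basis of $V^\rho$, with matrix elements $t^\rho_{ij}$, and let $c(\sigma i;\overline{\sigma}j\,|\,\gamma mn)$ (for $\sigma,\gamma\in\widehat{G}$) be the coupling coefficients defined in the context. For $\alpha\in\widehat{G}$ and $1\le k,l\le n^\alpha$ let $\widetilde{\lambda}(\overline{t^\alpha_{kl}};g_0)$ be the weighted class operator on the group algebra $L^2(G)$, $$\widetilde{\lambda}(\overline{t^\alpha_{kl}};g_0)=\int_G\overline{t^\alpha_{kl}(x)}\,\lambda(xg_0x^{-1})\,dx .$$ Then for all $\alpha,\sigma,\gamma\in\widehat{G}$ and all indices $1\le k,l\le n^\alpha$, $1\le i,j\le n^\sigma$, $1\le u,v\le n^\gamma$, $$n^\sigma\bigl\langle\widetilde{\lambda}(\overline{t^\alpha_{kl}};g_0)\,\overline{t^\sigma_{ij}}\,\big|\,\overline{t^\gamma_{uv}}\bigr\rangle=\frac{1}{n^\alpha}\,\delta_{\gamma\sigma}\,\delta_{jv}\sum_{m=1}^{m(\sigma;\alpha)}\overline{c(\sigma u;\overline{\sigma}i\,|\,\alpha mk)}\,\Bigl(\sum_{p,r=1}^{n^\sigma}c(\sigma p;\overline{\sigma}r\,|\,\alpha ml)\,t^\sigma_{pr}(g_0)\Bigr).$$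
   Context: $G$ is a compact group with Haar measure $dx$ normalized by $\int_G dx=1$; $\widehat{G}$ is the set of equivalence classes of irreducible unitary representations of $G$, and $n^\rho$ is the dimension of $\rho\in\widehat{G}$. Inner products are linear in the first variable; on $L^2(G)$, $\langle\phi\,|\,\psi\rangle=\int_G\phi(g)\overline{\psi(g)}\,dg$. The group algebra of $G$ is $L^2(G)$ with convolution. The left regular representation is $\lambda(g)f(y)=f(g^{-1}y)$, and operator-valued integrals are taken in the strong sense. Matrix elements: with $\{v_i\}$ the chosen orthonormal basis of $V^\rho$, $t^\rho_{ij}(g)=\langle T^\rho(g)v_j\,|\,v_i\rangle$, so $t^\rho_{ij}(g^{-1})=\overline{t^\rho_{ji}(g)}$. $\overline{t^\rho_{ij}}$ denotes the complex conjugate function. Coupling coefficients: for $\sigma\in\widehat{G}$, let $L(V^\sigma)$ be the space of linear operators on $V^\sigma$ with the inner product $\langle A\,|\,B\rangle=\mathrm{tr}(AB^* )$, and let $G$ act on it by the conjugation representation $A\mapsto T^\sigma(g)AT^\sigma(g)^{-1}$. Let $m(\sigma;\gamma)\ge 0$ be the multiplicity of $\gamma\in\widehat{G}$ in this representation. Choose an orthonormal basis $\{e^\gamma_{mn}\}$ of $L(V^\sigma)$, where $\gamma$ runs over the classes with $m(\sigma;\gamma)>0$, $1\le m\le m(\sigma;\gamma)$, $1\le n\le n^\gamma$, such that for fixed $\gamma,m$ the vectors $e^\gamma_{mn}$ span an invariant subspace and transform by the fixed matrices of $\gamma$: $T^\sigma(g)e^\gamma_{mn}T^\sigma(g)^{-1}=\sum_q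 t^\gamma_{qn}(g)e^\gamma_{mq}$. With $\{v_i\}$ the chosen orthonormal basis of $V^\sigma$, let $E_{ij}\in L(V^\sigma)$ be the matrix unit $E_{ij}(v)=\langle v\,|\,v_j\rangle v_i$. The coupling coefficients $c(\sigma i;\overline{\sigma}j\,|\,\gamma mn)$ are defined by $$E_{ij}=\sum_{\gamma,m,n}c(\sigma i;\overline{\sigma}j\,|\,\gamma mn)\,e^\gamma_{mn}.$$ If $m(\sigma;\alpha)=0$, a sum over $1\le m\le m(\sigma;\alpha)$ is empty, i.e. zero. *)

theory Defs
  imports "HOL-Probability.Probability_Measure" "Jordan_Normal_Form.Schur_Decomposition"
    "Jordan_Normal_Form.VS_Connect"
begin

unbundle no vec_syntax and no inner_syntax

section \<open>Compact groups and Haar measure\<close>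

locale compact_group = group G
  for G :: "'g monoid" (structure) +
  fixes X :: "'g topology"
  assumes topspace_eq: "topspace X = carrier G"
    and compact: "compact_space X"
    and Hausdorff: "Hausdorff_space X"
    and continuous_mult: "continuous_map (prod_topology X X) X (\<lambda>(x, y). x \<otimes> y)"
    and continuous_inv: "continuous_map X X (\<lambda>x. inv x)"

text \<open>Haar measure is the left-invariant regular Borel measure; the normalization is
  the \<^locale>\<open>prob_space\<close> axiom.\<close>

locale compact_group_haar = compact_group G X + prob_space \<mu>
  for G :: "'g monoid" (structure) and X :: "'g topology" and \<mu> :: "'g measure" +
  assumes space_haar: "space \<mu> = carrier G"
    and sets_haar: "sets \<mu> = sigma_sets (carrier G) {U. openin X U}"
    and left_invariant:
      "\<lbrakk>g \<in> carrier G; A \<in> sets \<mu>\<rbrakk> \<Longrightarrow> emeasure \<mu> (g <#\<^bsub>G\<^esub> A) = emeasure \<mu> A"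
    and outer_regular:
      "A \<in> sets \<mu> \<Longrightarrow> emeasure \<mu> A = (INF U \<in> {U. openin X U \<and> A \<subseteq> U}. emeasure \<mu> U)"
    and inner_regular:
      "openin X U \<Longrightarrow> emeasure \<mu> U = (SUP K \<in> {K. compactin X K \<and> K \<subseteq> U}. emeasure \<mu> K)"


section \<open>The group algebra and strong integrals\<close>

text \<open>Elements of $L^2(G)$ are represented by square-integrable functions; two functions
  equal almost everywhere represent the same element.\<close>

definition L2 :: "'g measure \<Rightarrow> ('g \<Rightarrow> complex) set" where
  "L2 \<mu> = {f \<in> borel_measurable \<mu>. integrable \<mu> (\<lambda>x. (norm (f x))\<^sup>2)}"

definition L2_inner :: "'g measure \<Rightarrow> ('g \<Rightarrow> complex) \<Rightarrow> ('g \<Rightarrow> complex) \<Rightarrow> complex" where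
  "L2_inner \<mu> f h = (LINT x|\<mu>. f x * cnj (h x))"

definition L2_norm :: "'g measure \<Rightarrow> ('g \<Rightarrow> complex) \<Rightarrow> real" where
  "L2_norm \<mu> f = sqrt (LINT x|\<mu>. (norm (f x))\<^sup>2)"

definition left_reg :: "'g monoid \<Rightarrow> 'g \<Rightarrow> ('g \<Rightarrow> complex) \<Rightarrow> ('g \<Rightarrow> complex)" where
  "left_reg G g f = (\<lambda>y. f (inv\<^bsub>G\<^esub> g \<otimes>\<^bsub>G\<^esub> y))"

text \<open>Bochner integration of functions with values in $L^2(\mu)$, following
  \<^const>\<open>has_bochner_integral\<close>, which does not apply here because $L^2(\mu)$ is neither a
  type nor (in general) separable.\<close>

definition simple_L2_integral ::
    "'g measure \<Rightarrow> ('g \<Rightarrow> ('g \<Rightarrow> complex)) \<Rightarrow> ('g \<Rightarrow> complex)" where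
  "simple_L2_integral \<mu> s =
     (\<lambda>y. \<Sum>h \<in> s ` space \<mu>. of_real (measure \<mu> {x \<in> space \<mu>. s x = h}) * h y)"

definition has_L2_integral ::
    "'g measure \<Rightarrow> ('g \<Rightarrow> ('g \<Rightarrow> complex)) \<Rightarrow> ('g \<Rightarrow> complex) \<Rightarrow> bool" where
  "has_L2_integral \<mu> F I \<longleftrightarrow>
     (\<forall>x \<in> space \<mu>. F x \<in> L2 \<mu>) \<and> I \<in> L2 \<mu> \<and>
     (\<exists>s. (\<forall>n. simple_function \<mu> (s n) \<and> (\<forall>x \<in> space \<mu>. s n x \<in> L2 \<mu>) \<and>
               integrable \<mu> (\<lambda>x. L2_norm \<mu> (\<lambda>y. F x y - s n x y))) \<and>
          (\<lambda>n. LINT x|\<mu>. L2_norm \<mu> (\<lambda>y. F x y - s n x y)) \<longlonglongrightarrow> 0 \<and>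
          (\<lambda>n. L2_norm \<mu> (\<lambda>y. I y - simple_L2_integral \<mu> (s n) y)) \<longlonglongrightarrow> 0)"

text \<open>The strong integral of an operator-valued function \<open>K\<close> maps \<open>f\<close> to the
  $L^2$-valued integral of \<open>x \<mapsto> K x f\<close>; its value is unique up to null sets.\<close>

definition strong_integral ::
    "'g measure \<Rightarrow> ('g \<Rightarrow> ('g \<Rightarrow> complex) \<Rightarrow> ('g \<Rightarrow> complex)) \<Rightarrow>
     ('g \<Rightarrow> complex) \<Rightarrow> ('g \<Rightarrow> complex)" where
  "strong_integral \<mu> K f = (SOME I. has_L2_integral \<mu> (\<lambda>x. K x f) I)"

definition weighted_class_op ::
    "'g monoid \<Rightarrow> 'g measure \<Rightarrow> ('g \<Rightarrow> complex) \<Rightarrow> 'g \<Rightarrow>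
     ('g \<Rightarrow> complex) \<Rightarrow> ('g \<Rightarrow> complex)" where
  "weighted_class_op G \<mu> \<phi> g\<^sub>0 =
     strong_integral \<mu>
       (\<lambda>x f y. \<phi> x * left_reg G (x \<otimes>\<^bsub>G\<^esub> g\<^sub>0 \<otimes>\<^bsub>G\<^esub> inv\<^bsub>G\<^esub> x) f y)"


section \<open>Irreducible unitary representations\<close>

text \<open>Irreducible unitary representations of a compact group are finite-dimensional, so they
  are taken on the Hilbert spaces $\mathbb{C}^n$, whose linear operators are the
  $n \times n$ matrices.\<close>

definition rep_dim :: "'g monoid \<Rightarrow> ('g \<Rightarrow> complex mat) \<Rightarrow> nat" where
  "rep_dim G R = dim_row (R \<one>\<^bsub>G\<^esub>)"

definition unitary_rep :: "'g monoid \<Rightarrow> 'g topology \<Rightarrow> ('g \<Rightarrow> complex mat) \<Rightarrow> bool" where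
  "unitary_rep G X R \<longleftrightarrow>
     (let n = rep_dim G R in
       (\<forall>g \<in> carrier G. R g \<in> carrier_mat n n \<and> mat_adjoint (R g) * R g = 1\<^sub>m n) \<and>
       R \<one>\<^bsub>G\<^esub> = 1\<^sub>m n \<and>
       (\<forall>g \<in> carrier G. \<forall>h \<in> carrier G. R (g \<otimes>\<^bsub>G\<^esub> h) = R g * R h) \<and>
       (\<forall>i < n. \<forall>j < n. continuous_map X euclidean (\<lambda>g. R g $$ (i, j))))"

definition irreducible_rep :: "'g monoid \<Rightarrow> 'g topology \<Rightarrow> ('g \<Rightarrow> complex mat) \<Rightarrow> bool" where
  "irreducible_rep G X R \<longleftrightarrow>
     unitary_rep G X R \<and> rep_dim G R > 0 \<and>
     (\<forall>W. VectorSpace.subspace class_ring W (module_vec TYPE(complex) (rep_dim G R)) \<and>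
          (\<forall>g \<in> carrier G. \<forall>w \<in> W. R g *\<^sub>v w \<in> W) \<longrightarrow>
          W = {0\<^sub>v (rep_dim G R)} \<or> W = carrier_vec (rep_dim G R))"

definition equivalent_reps ::
    "'g monoid \<Rightarrow> ('g \<Rightarrow> complex mat) \<Rightarrow> ('g \<Rightarrow> complex mat) \<Rightarrow> bool" where
  "equivalent_reps G R S \<longleftrightarrow>
     (\<exists>P \<in> carrier_mat (rep_dim G S) (rep_dim G R).
        invertible_mat P \<and> (\<forall>g \<in> carrier G. P * R g = S g * P))"

definition unitary_dual :: "'g monoid \<Rightarrow> 'g topology \<Rightarrow> ('g \<Rightarrow> complex mat) set set" where
  "unitary_dual G X =
     {R. irreducible_rep G X R} //
     {(R, S). irreducible_rep G X R \<and> irreducible_rep G X S \<and> equivalent_reps G R S}"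

definition orthonormal_vec_basis :: "nat \<Rightarrow> (nat \<Rightarrow> complex vec) \<Rightarrow> bool" where
  "orthonormal_vec_basis n v \<longleftrightarrow>
     (\<forall>i < n. v i \<in> carrier_vec n) \<and>
     (\<forall>i < n. \<forall>j < n. v i \<bullet>c v j = (if i = j then 1 else 0)) \<and>
     (\<forall>w \<in> carrier_vec n. \<exists>a. w = vec n (\<lambda>r. \<Sum>i<n. a i * v i $ r))"

definition mat_elem ::
    "('g \<Rightarrow> complex mat) \<Rightarrow> (nat \<Rightarrow> complex vec) \<Rightarrow> nat \<Rightarrow> nat \<Rightarrow> 'g \<Rightarrow> complex" where
  "mat_elem R v i j g = (R g *\<^sub>v v j) \<bullet>c v i"


section \<open>The conjugation representation and coupling coefficients\<close>

definition mat_trace :: "complex mat \<Rightarrow> complex" where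
  "mat_trace A = (\<Sum>i < dim_row A. A $$ (i, i))"

definition mat_inner :: "complex mat \<Rightarrow> complex mat \<Rightarrow> complex" where
  "mat_inner A B = mat_trace (A * mat_adjoint B)"

definition mat_lincomb :: "nat \<Rightarrow> 'i set \<Rightarrow> ('i \<Rightarrow> complex) \<Rightarrow> ('i \<Rightarrow> complex mat) \<Rightarrow> complex mat"
  where "mat_lincomb n I a f = mat n n (\<lambda>rs. \<Sum>x \<in> I. a x * f x $$ rs)"

definition orthonormal_mat_basis :: "nat \<Rightarrow> 'i set \<Rightarrow> ('i \<Rightarrow> complex mat) \<Rightarrow> bool" where
  "orthonormal_mat_basis n I f \<longleftrightarrow>
     finite I \<and> (\<forall>x \<in> I. f x \<in> carrier_mat n n) \<and>
     (\<forall>x \<in> I. \<forall>y \<in> I. mat_inner (f x) (f y) = (if x = y then 1 else 0)) \<and>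
     (\<forall>A \<in> carrier_mat n n. \<exists>a. A = mat_lincomb n I a f)"

definition conj_act :: "'g monoid \<Rightarrow> ('g \<Rightarrow> complex mat) \<Rightarrow> 'g \<Rightarrow> complex mat \<Rightarrow> complex mat" where
  "conj_act G R g A = R g * A * R (inv\<^bsub>G\<^esub> g)"

text \<open>The list \<open>\<pi>s\<close> gives the irreducible constituents, with repetitions, of an orthogonal
  decomposition of the conjugation representation; \<open>f (s, q)\<close>, for \<open>q\<close> below the dimension of
  \<open>\<pi>s ! s\<close>, is a basis of the \<open>s\<close>-th summand in which \<open>G\<close> acts by the matrices of \<open>\<pi>s ! s\<close>.\<close>

definition conj_decomposition ::
    "'g monoid \<Rightarrow> 'g topology \<Rightarrow> ('g \<Rightarrow> complex mat) \<Rightarrow> ('g \<Rightarrow> complex mat) list \<Rightarrow>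
     (nat \<times> nat \<Rightarrow> complex mat) \<Rightarrow> bool" where
  "conj_decomposition G X R \<pi>s f \<longleftrightarrow>
     (\<forall>\<pi> \<in> set \<pi>s. irreducible_rep G X \<pi>) \<and>
     orthonormal_mat_basis (rep_dim G R) {(s, q). s < length \<pi>s \<and> q < rep_dim G (\<pi>s ! s)} f \<and>
     (\<forall>s < length \<pi>s. \<forall>q < rep_dim G (\<pi>s ! s). \<forall>g \<in> carrier G.
        conj_act G R g (f (s, q)) =
        mat_lincomb (rep_dim G R) {..< rep_dim G (\<pi>s ! s)}
          (\<lambda>p. (\<pi>s ! s) g $$ (p, q)) (\<lambda>p. f (s, p)))"

definition conj_multiplicity ::
    "'g monoid \<Rightarrow> 'g topology \<Rightarrow> ('g \<Rightarrow> complex mat) \<Rightarrow> ('g \<Rightarrow> complex mat) set \<Rightarrow> nat" where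
  "conj_multiplicity G X R \<gamma> =
     (THE m. \<exists>\<pi>s f. conj_decomposition G X R \<pi>s f \<and> m = length (filter (\<lambda>\<pi>. \<pi> \<in> \<gamma>) \<pi>s))"

text \<open>Below, \<open>T \<rho>\<close> is the chosen representation in the class \<open>\<rho>\<close> and \<open>b \<rho>\<close> the chosen
  orthonormal basis of its space. All basis and multiplicity indices start from 0.\<close>

definition coupling_index ::
    "'g monoid \<Rightarrow> 'g topology \<Rightarrow> (('g \<Rightarrow> complex mat) set \<Rightarrow> 'g \<Rightarrow> complex mat) \<Rightarrow>
     ('g \<Rightarrow> complex mat) set \<Rightarrow> (('g \<Rightarrow> complex mat) set \<times> nat \<times> nat) set" where
  "coupling_index G X T \<sigma> =
     {(\<gamma>, m, q). \<gamma> \<in> unitary_dual G X \<and> m < conj_multiplicity G X (T \<sigma>) \<gamma> \<and> q < rep_dim G (T \<gamma>)}"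

definition coupling_basis ::
    "'g monoid \<Rightarrow> 'g topology \<Rightarrow> (('g \<Rightarrow> complex mat) set \<Rightarrow> 'g \<Rightarrow> complex mat) \<Rightarrow>
     (('g \<Rightarrow> complex mat) set \<Rightarrow> nat \<Rightarrow> complex vec) \<Rightarrow> ('g \<Rightarrow> complex mat) set \<Rightarrow>
     (('g \<Rightarrow> complex mat) set \<Rightarrow> nat \<Rightarrow> nat \<Rightarrow> complex mat) \<Rightarrow> bool" where
  "coupling_basis G X T b \<sigma> e \<longleftrightarrow>
     orthonormal_mat_basis (rep_dim G (T \<sigma>)) (coupling_index G X T \<sigma>) (\<lambda>(\<gamma>, m, q). e \<gamma> m q) \<and>
     (\<forall>(\<gamma>, m, q) \<in> coupling_index G X T \<sigma>. \<forall>g \<in> carrier G.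
        conj_act G (T \<sigma>) g (e \<gamma> m q) =
        mat_lincomb (rep_dim G (T \<sigma>)) {..< rep_dim G (T \<gamma>)}
          (\<lambda>p. mat_elem (T \<gamma>) (b \<gamma>) p q g) (\<lambda>p. e \<gamma> m p))"

definition matrix_unit :: "nat \<Rightarrow> (nat \<Rightarrow> complex vec) \<Rightarrow> nat \<Rightarrow> nat \<Rightarrow> complex mat" where
  "matrix_unit n v i j = mat n n (\<lambda>(r, s). v i $ r * cnj (v j $ s))"

lemma matrix_unit_apply:
  assumes "v i \<in> carrier_vec n" "v j \<in> carrier_vec n" "w \<in> carrier_vec n"
  shows "matrix_unit n v i j *\<^sub>v w = (w \<bullet>c v j) \<cdot>\<^sub>v v i"
  using assms
  by (intro eq_vecI)
     (auto simp: matrix_unit_def scalar_prod_def sum_distrib_left sum_distrib_right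
        intro!: sum.cong)

definition coupling_coeffs ::
    "'g monoid \<Rightarrow> 'g topology \<Rightarrow> (('g \<Rightarrow> complex mat) set \<Rightarrow> 'g \<Rightarrow> complex mat) \<Rightarrow>
     (('g \<Rightarrow> complex mat) set \<Rightarrow> nat \<Rightarrow> complex vec) \<Rightarrow> ('g \<Rightarrow> complex mat) set \<Rightarrow>
     (('g \<Rightarrow> complex mat) set \<Rightarrow> nat \<Rightarrow> nat \<Rightarrow> complex mat) \<Rightarrow>
     (nat \<Rightarrow> nat \<Rightarrow> ('g \<Rightarrow> complex mat) set \<Rightarrow> nat \<Rightarrow> nat \<Rightarrow> complex) \<Rightarrow> bool" where
  "coupling_coeffs G X T b \<sigma> e c \<longleftrightarrow>
     (\<forall>i < rep_dim G (T \<sigma>). \<forall>j < rep_dim G (T \<sigma>).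
        matrix_unit (rep_dim G (T \<sigma>)) (b \<sigma>) i j =
        mat_lincomb (rep_dim G (T \<sigma>)) (coupling_index G X T \<sigma>)
          (\<lambda>(\<gamma>, m, q). c i j \<gamma> m q) (\<lambda>(\<gamma>, m, q). e \<gamma> m q))"

end

theory Submission
  imports Defs "Jordan_Normal_Form.Spectral_Radius"
begin

text \<open>Write \<open>t\<close> for the matrix elements of \<open>\<sigma>\<close>. Since \<open>\<lambda>(h)\<close> maps the conjugate of \<open>t\<^sub>i\<^sub>j\<close> to
  \<open>\<Sum>\<^sub>q t\<^sub>q\<^sub>i(h)\<close> times the conjugate of \<open>t\<^sub>q\<^sub>j\<close>, the integrand of the weighted class operator takes values
  in a fixed finite-dimensional space, so the strong integral may be computed coefficientwise, and
  Schur orthogonality reduces the left-hand side to the integral of \<open>t\<^sub>u\<^sub>i(x g\<^sub>0 x\<^sup>-\<^sup>1)\<close> against the conjugate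
  of the matrix element of \<open>\<alpha>\<close>. Expanding \<open>T \<sigma> g\<^sub>0\<close> in the basis \<open>e\<close>, on which conjugation by \<open>x\<close> acts
  through matrix elements, a second use of Schur orthogonality isolates the terms of type \<open>\<alpha>\<close>.\<close>

section \<open>Schur's lemma\<close>

text \<open>The obstacle is that \<open>weighted_class_op\<close> is known only as some function
  satisfying \<open>has_L2_integral\<close>, fixed at best up to null sets, so nothing can be said
  about its values at points. It is therefore studied through pairings with a bounded function,
  which agree for all candidates and turn the vector integral into a scalar one; that a candidate
  exists at all comes from the finite-dimensional range. The orthogonality relations are proved for
  bare matrix entries, where averaging a matrix unit over the group gives an intertwiner, and are
  carried over to the bases \<open>b\<close> by sesquilinearity. The index pattern of the result has
  two origins: the inverse in the left regular representation moves i to a column position, and the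
  conjugate on a coupling coefficient appears because \<open>E_ui\<close> stands in the antilinear
  slot of the trace inner product. The factor n^\<sigma> cancels the constant of the orthogonality
  relation for \<sigma>, whereas 1/n^\<alpha> is the constant of the relation for \<alpha>.\<close>

lemma mat_adjoint_carrier [simp]:
  "A \<in> carrier_mat m n \<Longrightarrow> mat_adjoint A \<in> carrier_mat n m"
  by (auto simp: mat_adjoint_def)

lemma mat_adjoint_dim [simp]:
  "dim_row (mat_adjoint A) = dim_col A" "dim_col (mat_adjoint A) = dim_row A"
  by (auto simp: mat_adjoint_def)

lemma mat_adjoint_index [simp]:
  fixes A :: "complex mat"
  assumes "i < dim_col A" "j < dim_row A"
  shows "mat_adjoint A $$ (i, j) = cnj (A $$ (j, i))"
  using assms by (simp add: mat_adjoint_def mat_of_rows_def)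

lemma index_mat_mult_sum:
  assumes "A \<in> carrier_mat m n" "B \<in> carrier_mat n p" "i < m" "j < p"
  shows "(A * B) $$ (i, j) = (\<Sum>q<n. A $$ (i, q) * B $$ (q, j))"
  using assms by (auto simp: scalar_prod_def lessThan_atLeast0 intro!: sum.cong)

lemma invertible_matI:
  assumes "A \<in> carrier_mat n n" "B \<in> carrier_mat n n" "A * B = 1\<^sub>m n" "B * A = 1\<^sub>m n"
  shows "invertible_mat A"
  using assms unfolding invertible_mat_def inverts_mat_def by auto

lemma invertible_matE:
  assumes "invertible_mat A" "A \<in> carrier_mat n n"
  obtains B where "B \<in> carrier_mat n n" "A * B = 1\<^sub>m n" "B * A = 1\<^sub>m n"
proof -
  from assms(1) obtain B where B: "inverts_mat A B" "inverts_mat B A"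
    unfolding invertible_mat_def by auto
  then have "B \<in> carrier_mat n n" using assms(2) unfolding inverts_mat_def
    by (metis carrier_matD carrier_matI index_mult_mat(2,3) index_one_mat(2,3))
  then show thesis using that B assms(2) unfolding inverts_mat_def by auto
qed

lemma unitary_repD:
  assumes "unitary_rep G X R" "g \<in> carrier G"
  shows "R g \<in> carrier_mat (rep_dim G R) (rep_dim G R)"
    and "mat_adjoint (R g) * R g = 1\<^sub>m (rep_dim G R)"
    and "R \<one>\<^bsub>G\<^esub> = 1\<^sub>m (rep_dim G R)"
    and "h \<in> carrier G \<Longrightarrow> R (g \<otimes>\<^bsub>G\<^esub> h) = R g * R h"
  using assms unfolding unitary_rep_def Let_def by auto

lemma unitary_rep_continuous:
  assumes "unitary_rep G X R" "i < rep_dim G R" "j < rep_dim G R"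
  shows "continuous_map X euclidean (\<lambda>g. R g $$ (i, j))"
  using assms unfolding unitary_rep_def Let_def by auto

text \<open>Unitarity is given as a left inverse identity: multiplying
  \<open>R g * R (inv g) = 1\<close> by the adjoint from the left cancels
  \<open>R g\<close>.\<close>

lemma unitary_rep_inv:
  assumes "group G" and R: "unitary_rep G X R" and g: "g \<in> carrier G"
  shows "R (inv\<^bsub>G\<^esub> g) = mat_adjoint (R g)"
proof -
  interpret group G by fact
  note c = unitary_repD(1)[OF R]
  have "mat_adjoint (R g) = mat_adjoint (R g) * R (g \<otimes>\<^bsub>G\<^esub> inv\<^bsub>G\<^esub> g)"
    using c[OF g] unitary_repD(3)[OF R g] g by auto
  also have "\<dots> = (mat_adjoint (R g) * R g) * R (inv\<^bsub>G\<^esub> g)"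
    unfolding unitary_repD(4)[OF R g inv_closed[OF g]]
    using c[OF g] c[OF inv_closed[OF g]] assoc_mult_mat mat_adjoint_carrier by metis
  also have "\<dots> = R (inv\<^bsub>G\<^esub> g)"
    using c[OF inv_closed[OF g]] unitary_repD(2)[OF R g] by simp
  finally show ?thesis by simp
qed

text \<open>Bridge from the module-theoretic \<open>subspace\<close> locale in
  \<open>irreducible_rep\<close> to plain vector operations: kernels and images can then be tested
  by their closure properties.\<close>

lemma irreducible_rep_invariant:
  assumes R: "irreducible_rep G X R" and n: "n = rep_dim G R"
    and W: "W \<subseteq> carrier_vec n" "0\<^sub>v n \<in> W"
      "\<And>x y. x \<in> W \<Longrightarrow> y \<in> W \<Longrightarrow> x + y \<in> W" "\<And>a x. x \<in> W \<Longrightarrow> a \<cdot>\<^sub>v x \<in> W"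
    and inv: "\<And>g x. g \<in> carrier G \<Longrightarrow> x \<in> W \<Longrightarrow> R g *\<^sub>v x \<in> W"
  shows "W = {0\<^sub>v n} \<or> W = carrier_vec n"
proof -
  interpret V: vectorspace "class_ring :: complex ring" "module_vec TYPE(complex) n"
    by (rule vec_vs)
  have "VectorSpace.subspace class_ring W (module_vec TYPE(complex) n)"
    by (intro subspace.intro submodule.intro V.vectorspace_axioms V.module_axioms)
       (use W in \<open>auto simp: module_vec_simps\<close>)
  with R inv show ?thesis
    unfolding irreducible_rep_def n by blast
qed

text \<open>The kernel of \<open>P\<close> is invariant under \<open>R\<close> and its image under
  \<open>S\<close>, so each is trivial or everything. A full kernel gives the zero matrix; a zero
  kernel together with a full image gives a bijection, whose inverse is assembled column by column.
  Equality of the two dimensions has to be derived, because \<open>invertible_mat\<close> includes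
  squareness.\<close>

lemma intertwiner_trivial_or_invertible:
  assumes R: "irreducible_rep G X R" and S: "irreducible_rep G X S"
    and P: "P \<in> carrier_mat (rep_dim G S) (rep_dim G R)"
    and PR: "\<And>g. g \<in> carrier G \<Longrightarrow> P * R g = S g * P"
  shows "P = 0\<^sub>m (rep_dim G S) (rep_dim G R) \<or> invertible_mat P"
proof -
  define n m where "n = rep_dim G R" and "m = rep_dim G S"
  note P = P[folded n_def m_def]
  have uR: "unitary_rep G X R" and uS: "unitary_rep G X S"
    using R S unfolding irreducible_rep_def by auto
  note cR = unitary_repD(1)[OF uR, folded n_def] and cS = unitary_repD(1)[OF uS, folded m_def]
  have intertwine: "P *\<^sub>v (R g *\<^sub>v x) = S g *\<^sub>v (P *\<^sub>v x)"
    if "g \<in> carrier G" "x \<in> carrier_vec n" for g x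
    using that P cR[OF that(1)] cS[OF that(1)] PR[OF that(1)]
    by (metis assoc_mult_mat_vec)
  let ?K = "{x \<in> carrier_vec n. P *\<^sub>v x = 0\<^sub>v m}"
  have "?K = {0\<^sub>v n} \<or> ?K = carrier_vec n"
  proof (rule irreducible_rep_invariant[OF R n_def])
    show "x + y \<in> ?K" if "x \<in> ?K" "y \<in> ?K" for x y
      using that P by (auto simp: mult_add_distrib_mat_vec)
    show "a \<cdot>\<^sub>v x \<in> ?K" if "x \<in> ?K" for a x
      using that P by (auto simp: mult_mat_vec)
    show "R g *\<^sub>v x \<in> ?K" if "g \<in> carrier G" "x \<in> ?K" for g x
    proof -
      have "P *\<^sub>v (R g *\<^sub>v x) = S g *\<^sub>v 0\<^sub>v m"
        using intertwine[of g x] that by simp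
      also have "\<dots> = 0\<^sub>v m" using cS[OF that(1)] by auto
      finally show ?thesis using cR[OF that(1)] that by auto
    qed
  qed (use P in auto)
  then show ?thesis
  proof
    assume K: "?K = carrier_vec n"
    have "P = 0\<^sub>m m n"
    proof (rule eq_matI)
      fix i j assume ij: "i < dim_row (0\<^sub>m m n)" "j < dim_col (0\<^sub>m m n)"
      have "unit_vec n j \<in> ?K" unfolding K by simp
      then have "(P *\<^sub>v unit_vec n j) $ i = 0" using ij by simp
      moreover have "(P *\<^sub>v unit_vec n j) $ i = P $$ (i, j)"
        using P ij by (simp add: scalar_prod_right_unit)
      ultimately show "P $$ (i, j) = 0\<^sub>m m n $$ (i, j)" using ij by simp
    qed (use P in auto)
    then show ?thesis by (simp add: n_def m_def)
  next
    assume K: "?K = {0\<^sub>v n}"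
    let ?I = "(\<lambda>x. P *\<^sub>v x) ` carrier_vec n"
    have "?I = {0\<^sub>v m} \<or> ?I = carrier_vec m"
    proof (rule irreducible_rep_invariant[OF S m_def])
      show "0\<^sub>v m \<in> ?I" using P by (intro image_eqI[of _ _ "0\<^sub>v n"]) auto
      show "x + y \<in> ?I" if "x \<in> ?I" "y \<in> ?I" for x y
      proof -
        from that obtain x' y' where "x' \<in> carrier_vec n" "y' \<in> carrier_vec n"
          "x = P *\<^sub>v x'" "y = P *\<^sub>v y'" by auto
        then have "x + y = P *\<^sub>v (x' + y')" "x' + y' \<in> carrier_vec n"
          using P by (auto simp: mult_add_distrib_mat_vec)
        then show ?thesis by blast
      qed
      show "a \<cdot>\<^sub>v x \<in> ?I" if "x \<in> ?I" for a x
      proof -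
        from that obtain x' where "x' \<in> carrier_vec n" "x = P *\<^sub>v x'" by auto
        then have "a \<cdot>\<^sub>v x = P *\<^sub>v (a \<cdot>\<^sub>v x')" "a \<cdot>\<^sub>v x' \<in> carrier_vec n"
          using P by (auto simp: mult_mat_vec)
        then show ?thesis by blast
      qed
      show "S g *\<^sub>v x \<in> ?I" if "g \<in> carrier G" "x \<in> ?I" for g x
      proof -
        from that obtain x' where "x' \<in> carrier_vec n" "x = P *\<^sub>v x'" by auto
        then have "S g *\<^sub>v x = P *\<^sub>v (R g *\<^sub>v x')" "R g *\<^sub>v x' \<in> carrier_vec n"
          using intertwine[OF that(1)] cR[OF that(1)] by auto
        then show ?thesis by blast
      qed
    qed (use P in auto)
    then show ?thesis
    proof
      assume I: "?I = {0\<^sub>v m}"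
      \<comment> \<open>A zero image would put a unit vector into the kernel, which is excluded
        because the dimension is positive.\<close>
      then have "P *\<^sub>v unit_vec n 0 = 0\<^sub>v m" by (metis image_eqI singletonD unit_vec_carrier)
      then have "unit_vec n 0 \<in> ?K" by simp
      then have "unit_vec n 0 = (0\<^sub>v n :: complex vec)" unfolding K by simp
      moreover have "n > 0" using R unfolding irreducible_rep_def n_def by auto
      ultimately show ?thesis by (metis index_unit_vec(1) index_zero_vec(1) zero_neq_one)
    next
      assume I: "?I = carrier_vec m"
      then have "\<forall>j. \<exists>w. w \<in> carrier_vec n \<and> P *\<^sub>v w = unit_vec m j"
        by (metis (mono_tags, lifting) image_iff unit_vec_carrier)
      then obtain w where w: "\<And>j. w j \<in> carrier_vec n" "\<And>j. P *\<^sub>v w j = unit_vec m j"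
        by metis
      \<comment> \<open>The columns of \<open>Q\<close> are preimages of the unit vectors, which
        makes it a right inverse of \<open>P\<close>.\<close>
      define Q where "Q = mat n m (\<lambda>(i, j). w j $ i)"
      have Q: "Q \<in> carrier_mat n m" by (simp add: Q_def)
      have colQ: "col Q j = w j" if "j < m" for j
        using that w(1)[of j] by (auto simp: Q_def)
      have PQ: "P * Q = 1\<^sub>m m"
      proof (rule mat_col_eqI)
        fix j assume j: "j < dim_col (1\<^sub>m m :: complex mat)"
        then have "col (P * Q) j = P *\<^sub>v col Q j" using P Q by (auto intro: col_mult2)
        also have "\<dots> = col (1\<^sub>m m) j" using j colQ w(2) by simp
        finally show "col (P * Q) j = col (1\<^sub>m m) j" .
      qed (use P Q in auto)
      have QP: "Q * P = 1\<^sub>m n"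
      proof (rule mat_col_eqI)
        fix j assume j: "j < dim_col (1\<^sub>m n :: complex mat)"
        \<comment> \<open>\<open>?x\<close> is the defect of \<open>Q * P\<close> on the j-th unit
          vector. It is killed by \<open>P\<close> because \<open>P * Q = 1\<close>, hence it
          vanishes by injectivity.\<close>
        let ?x = "Q *\<^sub>v (P *\<^sub>v unit_vec n j) - unit_vec n j"
        have uv: "P *\<^sub>v unit_vec n j \<in> carrier_vec m" using P by auto
        have "P *\<^sub>v ?x = P *\<^sub>v (Q *\<^sub>v (P *\<^sub>v unit_vec n j)) - P *\<^sub>v unit_vec n j"
          using P Q by (intro mult_minus_distrib_mat_vec) auto
        also have "P *\<^sub>v (Q *\<^sub>v (P *\<^sub>v unit_vec n j)) = (P * Q) *\<^sub>v (P *\<^sub>v unit_vec n j)"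
          using P Q uv by (metis assoc_mult_mat_vec)
        finally have "P *\<^sub>v ?x = 0\<^sub>v m" using uv unfolding PQ by simp
        then have "?x \<in> ?K" using P Q by auto
        then have "?x = 0\<^sub>v n" unfolding K by simp
        then have x: "Q *\<^sub>v (P *\<^sub>v unit_vec n j) = unit_vec n j"
          using P Q by (auto simp: vec_eq_iff)
        have "col (Q * P) j = Q *\<^sub>v col P j" using j P Q by (auto intro: col_mult2)
        also have "col P j = P *\<^sub>v unit_vec n j" using P j by auto
        finally show "col (Q * P) j = col (1\<^sub>m n) j" using x j by simp
      qed (use P Q in auto)
      text \<open>\<open>tr (P Q) = tr (Q P)\<close> forces the two dimensions to agree.\<close>
      have "of_nat m = (\<Sum>i<m. (P * Q) $$ (i, i))" unfolding PQ by simp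
      also have "\<dots> = (\<Sum>i<m. \<Sum>j<n. P $$ (i, j) * Q $$ (j, i))"
        using index_mat_mult_sum[OF P Q] by (auto intro!: sum.cong)
      also have "\<dots> = (\<Sum>j<n. \<Sum>i<m. Q $$ (j, i) * P $$ (i, j))"
        by (subst sum.swap) (simp add: mult.commute)
      also have "\<dots> = (\<Sum>j<n. (Q * P) $$ (j, j))"
        using index_mat_mult_sum[OF Q P] by (auto intro!: sum.cong)
      also have "\<dots> = of_nat n" unfolding QP by simp
      finally have "m = n" by simp
      then have "invertible_mat P" using P Q PQ QP by (auto intro: invertible_matI)
      then show ?thesis ..
    qed
  qed
qed

text \<open>Over the complex numbers \<open>P\<close> has an eigenvalue \<open>a\<close>. The
  shifted matrix \<open>P - a 1\<close> still commutes with the representation but kills an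
  eigenvector, so it is not invertible, and the dichotomy for intertwiners makes it zero.\<close>

lemma irreducible_rep_commutant_scalar:
  assumes R: "irreducible_rep G X R"
    and P: "P \<in> carrier_mat (rep_dim G R) (rep_dim G R)"
    and PR: "\<And>g. g \<in> carrier G \<Longrightarrow> P * R g = R g * P"
  obtains a where "P = a \<cdot>\<^sub>m 1\<^sub>m (rep_dim G R)"
proof -
  define n where "n = rep_dim G R"
  note P = P[folded n_def]
  have uR: "unitary_rep G X R" and n: "n > 0"
    using R unfolding irreducible_rep_def n_def by auto
  note cR = unitary_repD(1)[OF uR, folded n_def]
  from spectrum_non_empty[OF P n] obtain a where a: "eigenvalue P a"
    unfolding spectrum_def by auto
  then obtain v where v: "v \<in> carrier_vec n" "v \<noteq> 0\<^sub>v n" "P *\<^sub>v v = a \<cdot>\<^sub>v v"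
    unfolding eigenvalue_def eigenvector_def using P by auto
  let ?D = "P - a \<cdot>\<^sub>m 1\<^sub>m n"
  have D: "?D \<in> carrier_mat n n" by (rule minus_carrier_mat) simp
  have "?D *\<^sub>v v = P *\<^sub>v v - (a \<cdot>\<^sub>m 1\<^sub>m n) *\<^sub>v v"
    using P v by (intro minus_mult_distrib_mat_vec) auto
  also have "(a \<cdot>\<^sub>m 1\<^sub>m n) *\<^sub>v v = a \<cdot>\<^sub>v v"
    using v by (intro eq_vecI) (auto simp: row_def scalar_prod_def if_distrib if_distribR cong: if_cong)
  finally have Dv: "?D *\<^sub>v v = 0\<^sub>v n" using v by simp
  have "?D = 0\<^sub>m n n \<or> invertible_mat ?D"
    unfolding n_def
  proof (rule intertwiner_trivial_or_invertible[OF R R], unfold n_def[symmetric])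
    fix g assume g: "g \<in> carrier G"
    show "?D * R g = R g * ?D"
      using P cR[OF g] PR[OF g]
      by (simp add: minus_mult_distrib_mat mult_minus_distrib_mat
          mult_smult_assoc_mat[of "1\<^sub>m n" n n "R g" n] mult_smult_distrib[of "R g" n n "1\<^sub>m n" n])
  qed (use D in auto)
  moreover have "\<not> invertible_mat ?D"
  proof
    assume "invertible_mat ?D"
    then obtain B where Bc: "B \<in> carrier_mat n n" and B: "B * ?D = 1\<^sub>m n"
      using D by (rule invertible_matE)
    have "v = (B * ?D) *\<^sub>v v" using v unfolding B by simp
    also have "\<dots> = B *\<^sub>v (?D *\<^sub>v v)" using Bc D v by simp
    also have "\<dots> = 0\<^sub>v n" unfolding Dv using Bc by auto
    finally show False using v by simp
  qed
  ultimately have D0: "?D = 0\<^sub>m n n" by simp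
  have "P = a \<cdot>\<^sub>m 1\<^sub>m n"
  proof (rule eq_matI)
    fix i j assume ij: "i < dim_row (a \<cdot>\<^sub>m 1\<^sub>m n)" "j < dim_col (a \<cdot>\<^sub>m 1\<^sub>m n)"
    then have "?D $$ (i, j) = 0" unfolding D0 by simp
    then show "P $$ (i, j) = (a \<cdot>\<^sub>m 1\<^sub>m n) $$ (i, j)" using ij P by simp
  qed (use P in auto)
  then show thesis using that n_def by simp
qed

section \<open>Haar integration and Schur orthogonality\<close>

lemma continuous_map_mult [continuous_intros]:
  fixes f g :: "'a \<Rightarrow> 'b::real_normed_algebra"
  shows "\<lbrakk>continuous_map X euclidean f; continuous_map X euclidean g\<rbrakk>
    \<Longrightarrow> continuous_map X euclidean (\<lambda>x. f x * g x)"
  by (simp add: continuous_map_atin tendsto_mult)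

lemma continuous_map_cnj [continuous_intros]:
  "continuous_map X euclidean f \<Longrightarrow> continuous_map X euclidean (\<lambda>x. cnj (f x))"
  by (simp add: continuous_map_atin tendsto_cnj)

lemma L2_inner_cong:
  assumes "\<And>x. x \<in> space \<mu> \<Longrightarrow> f x = f' x" "\<And>x. x \<in> space \<mu> \<Longrightarrow> h x = h' x"
  shows "L2_inner \<mu> f h = L2_inner \<mu> f' h'"
  unfolding L2_inner_def using assms by (intro Bochner_Integration.integral_cong) auto

lemma L2_inner_cnj: "L2_inner \<mu> (\<lambda>x. cnj (f x)) (\<lambda>x. cnj (h x)) = cnj (L2_inner \<mu> f h)"
  by (simp add: L2_inner_def flip: Bochner_Integration.integral_cnj)

context compact_group_haar
begin

lemma continuous_map_left_mult:
  assumes "g \<in> carrier G"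
  shows "continuous_map X X (\<lambda>x. g \<otimes> x)"
proof -
  have "continuous_map X X ((\<lambda>(x, y). x \<otimes> y) \<circ> (\<lambda>x. (g, x)))"
    using assms topspace_eq
    by (intro continuous_map_compose[OF _ continuous_mult] continuous_map_pairedI) auto
  then show ?thesis by (simp add: comp_def)
qed

lemma borel_measurable_continuous_map:
  fixes f :: "'g \<Rightarrow> 'b::topological_space"
  assumes "continuous_map X euclidean f"
  shows "f \<in> borel_measurable \<mu>"
proof (rule borel_measurableI)
  fix S :: "'b set" assume "open S"
  then have "openin X {x \<in> topspace X. f x \<in> S}"
    using assms by (intro openin_continuous_map_preimage[of _ euclidean]) auto
  moreover have "f -` S \<inter> space \<mu> = {x \<in> topspace X. f x \<in> S}"
    using topspace_eq space_haar by auto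
  ultimately show "f -` S \<inter> space \<mu> \<in> sets \<mu>"
    unfolding sets_haar by auto
qed

lemma continuous_map_bounded:
  fixes f :: "'g \<Rightarrow> 'b::real_normed_vector"
  assumes "continuous_map X euclidean f"
  obtains B where "\<And>x. x \<in> carrier G \<Longrightarrow> norm (f x) \<le> B"
proof -
  have "compactin euclidean (f ` topspace X)"
    using image_compactin[OF _ assms] compact by (simp add: compact_space_def)
  then have "bounded (f ` carrier G)"
    using topspace_eq compact_imp_bounded by auto
  then show thesis using that unfolding bounded_iff by auto
qed

text \<open>Compactness bounds the function, and bounded measurable functions are integrable for a
  probability measure.\<close>

lemma integrable_continuous_map:
  fixes f :: "'g \<Rightarrow> 'b::{banach, second_countable_topology}"
  assumes "continuous_map X euclidean f"
  shows "integrable \<mu> f"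
proof -
  obtain B where "\<And>x. x \<in> carrier G \<Longrightarrow> norm (f x) \<le> B"
    using continuous_map_bounded[OF assms] by blast
  then show ?thesis
    using borel_measurable_continuous_map[OF assms] space_haar
    by (intro integrable_const_bound[of _ B] AE_I2) auto
qed

lemma continuous_map_L2:
  assumes "continuous_map X euclidean f"
  shows "f \<in> L2 \<mu>"
proof -
  have "continuous_map X euclidean (\<lambda>x. (norm (f x))\<^sup>2)"
    using assms by (intro continuous_intros)
  then show ?thesis
    unfolding L2_def using integrable_continuous_map borel_measurable_continuous_map[OF assms]
    by auto
qed

text \<open>The invariance axiom concerns sets; it says that translation preserves the measure, and
  the change of variables formula turns this into a statement on integrals. Measurability of
  translation need only be checked on open sets.\<close>

lemma integral_left_mult:
  fixes f :: "'g \<Rightarrow> 'b::{banach, second_countable_topology}"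
  assumes g: "g \<in> carrier G" and f: "f \<in> borel_measurable \<mu>"
  shows "(LINT x|\<mu>. f (g \<otimes> x)) = (LINT x|\<mu>. f x)"
proof -
  have meas: "(\<lambda>x. g \<otimes> x) \<in> measurable \<mu> \<mu>"
  proof (rule measurable_sigma_sets[OF sets_haar])
    show "{U. openin X U} \<subseteq> Pow (carrier G)"
      using openin_subset topspace_eq by auto
    show "(\<lambda>x. g \<otimes> x) \<in> space \<mu> \<rightarrow> carrier G" using g space_haar by auto
    fix U assume "U \<in> {U. openin X U}"
    then have "openin X {x \<in> topspace X. g \<otimes> x \<in> U}"
      using continuous_map_left_mult[OF g] by (intro openin_continuous_map_preimage) auto
    moreover have "(\<lambda>x. g \<otimes> x) -` U \<inter> space \<mu> = {x \<in> topspace X. g \<otimes> x \<in> U}"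
      using topspace_eq space_haar by auto
    ultimately show "(\<lambda>x. g \<otimes> x) -` U \<inter> space \<mu> \<in> sets \<mu>" unfolding sets_haar by auto
  qed
  have "distr \<mu> \<mu> (\<lambda>x. g \<otimes> x) = \<mu>"
  proof (rule measure_eqI)
    fix A assume "A \<in> sets (distr \<mu> \<mu> (\<lambda>x. g \<otimes> x))"
    then have A: "A \<in> sets \<mu>" by simp
    then have sub: "A \<subseteq> carrier G" using sets.sets_into_space space_haar by blast
    \<comment> \<open>The preimage of \<open>A\<close> under translation by \<open>g\<close> is the
      translate of \<open>A\<close> by \<open>inv g\<close>, so the axiom is used at
      \<open>inv g\<close>.\<close>
    have "(\<lambda>x. g \<otimes> x) -` A \<inter> space \<mu> = inv g <# A"
    proof (intro equalityI subsetI)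
      fix x assume "x \<in> (\<lambda>x. g \<otimes> x) -` A \<inter> space \<mu>"
      then have "x \<in> carrier G" "g \<otimes> x \<in> A" using space_haar by auto
      moreover from this have "x = inv g \<otimes> (g \<otimes> x)" using g by (simp add: m_assoc[symmetric])
      ultimately show "x \<in> inv g <# A" unfolding l_coset_def by blast
    next
      fix x assume "x \<in> inv g <# A"
      then obtain a where "a \<in> A" "x = inv g \<otimes> a" unfolding l_coset_def by auto
      then show "x \<in> (\<lambda>x. g \<otimes> x) -` A \<inter> space \<mu>"
        using g sub space_haar by (auto simp: m_assoc[symmetric])
    qed
    then show "emeasure (distr \<mu> \<mu> (\<lambda>x. g \<otimes> x)) A = emeasure \<mu> A"
      using A meas left_invariant[of "inv g" A] g by (simp add: emeasure_distr)
  qed simp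
  then show ?thesis using integral_distr[OF meas f] by simp
qed

text \<open>Continuity makes every product integrable. A single function in either slot is fed in as
  a sum over a one-element set with coefficient 1.\<close>

lemma L2_inner_lincomb:
  assumes "\<And>p. p \<in> I \<Longrightarrow> continuous_map X euclidean (f p)"
    and "\<And>q. q \<in> J \<Longrightarrow> continuous_map X euclidean (h q)"
  shows "L2_inner \<mu> (\<lambda>x. \<Sum>p\<in>I. a p * f p x) (\<lambda>x. \<Sum>q\<in>J. c q * h q x)
    = (\<Sum>p\<in>I. \<Sum>q\<in>J. a p * cnj (c q) * L2_inner \<mu> (f p) (h q))"
proof -
  have int: "integrable \<mu> (\<lambda>x. f p x * cnj (h q x))" if "p \<in> I" "q \<in> J" for p q
    using that assms by (intro integrable_continuous_map continuous_intros) auto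
  have "L2_inner \<mu> (\<lambda>x. \<Sum>p\<in>I. a p * f p x) (\<lambda>x. \<Sum>q\<in>J. c q * h q x)
    = (LINT x|\<mu>. (\<Sum>p\<in>I. \<Sum>q\<in>J. a p * cnj (c q) * (f p x * cnj (h q x))))"
    unfolding L2_inner_def
    by (intro Bochner_Integration.integral_cong)
       (simp_all add: cnj_sum sum_product mult_ac)
  also have "\<dots> = (\<Sum>p\<in>I. \<Sum>q\<in>J. a p * cnj (c q) * L2_inner \<mu> (f p) (h q))"
    unfolding L2_inner_def using int
    by (simp add: Bochner_Integration.integral_sum Bochner_Integration.integrable_sum)
  finally show ?thesis .
qed

text \<open>\<open>P\<close> is the integral of \<open>S x * E_bd * adjoint (R x)\<close>, the
  average of a matrix unit over the group. Translating x by \<open>g\<close> multiplies the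
  integrand by \<open>S g\<close> on the left and by the adjoint of \<open>R g\<close> on the
  right.\<close>

lemma averaged_intertwiner:
  assumes R: "unitary_rep G X R" and S: "unitary_rep G X S"
    and b: "b < rep_dim G S" and d: "d < rep_dim G R" and g: "g \<in> carrier G"
  defines "P \<equiv> mat (rep_dim G S) (rep_dim G R)
    (\<lambda>(a, c). L2_inner \<mu> (\<lambda>x. S x $$ (a, b)) (\<lambda>x. R x $$ (c, d)))"
  shows "P * R g = S g * P"
proof -
  define n m where "n = rep_dim G R" and "m = rep_dim G S"
  have P: "P \<in> carrier_mat m n" by (simp add: P_def n_def m_def)
  note cR = unitary_repD(1)[OF R, folded n_def] and cS = unitary_repD(1)[OF S, folded m_def]
  note contR = unitary_rep_continuous[OF R, folded n_def]
    and contS = unitary_rep_continuous[OF S, folded m_def]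
  have b: "b < m" and d: "d < n" using b d by (auto simp: n_def m_def)
  have P_index: "P $$ (a, c) = L2_inner \<mu> (\<lambda>x. S x $$ (a, b)) (\<lambda>x. R x $$ (c, d))"
    if "a < m" "c < n" for a c
    using that by (simp add: P_def n_def m_def)
  have ig: "inv g \<in> carrier G" using g by simp
  show ?thesis
  proof (rule eq_matI)
    fix a c assume "a < dim_row (S g * P)" "c < dim_col (S g * P)"
    then have a: "a < m" and c: "c < n" using P cS[OF g] by auto
    have Sg: "S (g \<otimes> x) $$ (a, b) = (\<Sum>q<m. S g $$ (a, q) * S x $$ (q, b))"
      if "x \<in> carrier G" for x
      using index_mat_mult_sum[OF cS[OF g] cS[OF that] a b] unitary_repD(4)[OF S g that] by simp
    have Rg: "R (inv g \<otimes> x) $$ (c, d) = (\<Sum>q<n. cnj (R g $$ (q, c)) * R x $$ (q, d))"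
      if "x \<in> carrier G" for x
      using index_mat_mult_sum[OF cR[OF ig] cR[OF that] c d] unitary_repD(4)[OF R ig that]
        unitary_rep_inv[OF is_group R g] cR[OF g] c by simp
    \<comment> \<open>\<open>?F\<close> integrates to the entry of \<open>S g * P\<close> and
      \<open>?H\<close> to that of \<open>P * R g\<close>. Since \<open>?F x\<close> equals
      \<open>?H\<close> at the translate of \<open>x\<close> by \<open>g\<close>, one left
      translation identifies the two.\<close>
    let ?F = "\<lambda>x. S (g \<otimes> x) $$ (a, b) * cnj (R x $$ (c, d))"
    let ?H = "\<lambda>x. S x $$ (a, b) * cnj (R (inv g \<otimes> x) $$ (c, d))"
    have "(S g * P) $$ (a, c) = (\<Sum>q<m. S g $$ (a, q) * P $$ (q, c))"
      using index_mat_mult_sum[OF cS[OF g] P a c] .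
    also have "\<dots> = L2_inner \<mu> (\<lambda>x. \<Sum>q<m. S g $$ (a, q) * S x $$ (q, b))
        (\<lambda>x. \<Sum>q\<in>{c}. 1 * R x $$ (q, d))"
      using contS contR b c d P_index by (subst L2_inner_lincomb) auto
    also have "\<dots> = (LINT x|\<mu>. ?F x)"
      unfolding L2_inner_def using Sg space_haar
      by (intro Bochner_Integration.integral_cong) auto
    also have "\<dots> = (LINT x|\<mu>. ?H (g \<otimes> x))"
      using g space_haar
      by (intro Bochner_Integration.integral_cong) (auto simp: m_assoc[symmetric])
    also have "\<dots> = (LINT x|\<mu>. ?H x)"
    proof (rule integral_left_mult[OF g])
      have "continuous_map X euclidean ((\<lambda>x. R x $$ (c, d)) \<circ> (\<lambda>x. inv g \<otimes> x))"
        by (rule continuous_map_compose[OF continuous_map_left_mult[OF ig] contR[OF c d]])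
      then show "?H \<in> borel_measurable \<mu>"
        using contS[OF a b] unfolding comp_def
        by (intro borel_measurable_continuous_map continuous_intros)
    qed
    also have "\<dots> = L2_inner \<mu> (\<lambda>x. \<Sum>q\<in>{a}. 1 * S x $$ (q, b))
        (\<lambda>x. \<Sum>q<n. cnj (R g $$ (q, c)) * R x $$ (q, d))"
      unfolding L2_inner_def using Rg space_haar
      by (intro Bochner_Integration.integral_cong) auto
    also have "\<dots> = (\<Sum>q<n. P $$ (a, q) * R g $$ (q, c))"
      using contS contR a b d P_index by (subst L2_inner_lincomb) (auto simp: mult.commute)
    also have "\<dots> = (P * R g) $$ (a, c)"
      using index_mat_mult_sum[OF P cR[OF g] a c] by simp
    finally show "(P * R g) $$ (a, c) = (S g * P) $$ (a, c)" by simp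
  qed (use P cR[OF g] cS[OF g] in auto)
qed

text \<open>A non-zero average would be invertible, hence an equivalence between the two
  representations.\<close>

lemma schur_orthogonality_inequivalent:
  assumes R: "irreducible_rep G X R" and S: "irreducible_rep G X S"
    and neq: "\<not> equivalent_reps G R S"
    and "a < rep_dim G S" "b < rep_dim G S" "c < rep_dim G R" "d < rep_dim G R"
  shows "L2_inner \<mu> (\<lambda>x. S x $$ (a, b)) (\<lambda>x. R x $$ (c, d)) = 0"
proof -
  have u: "unitary_rep G X R" "unitary_rep G X S"
    using R S unfolding irreducible_rep_def by auto
  let ?P = "mat (rep_dim G S) (rep_dim G R)
    (\<lambda>(a, c). L2_inner \<mu> (\<lambda>x. S x $$ (a, b)) (\<lambda>x. R x $$ (c, d)))"
  note PR = averaged_intertwiner[OF u assms(5) assms(7)]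
  have "?P = 0\<^sub>m (rep_dim G S) (rep_dim G R) \<or> invertible_mat ?P"
    by (rule intertwiner_trivial_or_invertible[OF R S _ PR]) auto
  moreover have "\<not> invertible_mat ?P"
  proof
    assume "invertible_mat ?P"
    moreover have "?P \<in> carrier_mat (rep_dim G S) (rep_dim G R)" by simp
    ultimately show False using neq PR unfolding equivalent_reps_def by blast
  qed
  ultimately have "?P $$ (a, c) = 0\<^sub>m (rep_dim G S) (rep_dim G R) $$ (a, c)" by metis
  then show ?thesis using assms by simp
qed

text \<open>The average is a scalar matrix \<open>z 1\<close>, which gives the Kronecker delta in
  the row indices. Taking traces determines \<open>z\<close>: unitarity of \<open>R x\<close>
  reduces the trace of the integrand to the delta in the column indices, and the total mass is
  1.\<close>

lemma schur_orthogonality: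
  assumes R: "irreducible_rep G X R"
    and abcd: "a < rep_dim G R" "b < rep_dim G R" "c < rep_dim G R" "d < rep_dim G R"
  shows "L2_inner \<mu> (\<lambda>x. R x $$ (a, b)) (\<lambda>x. R x $$ (c, d))
    = (if a = c \<and> b = d then 1 / of_nat (rep_dim G R) else 0)"
proof -
  define n where "n = rep_dim G R"
  note abcd = abcd[folded n_def]
  have u: "unitary_rep G X R" and n: "n > 0"
    using R unfolding irreducible_rep_def n_def by auto
  define P where "P = mat n n (\<lambda>(a, c). L2_inner \<mu> (\<lambda>x. R x $$ (a, b)) (\<lambda>x. R x $$ (c, d)))"
  note PR = averaged_intertwiner[OF u u assms(3) assms(5), folded n_def, folded P_def]
  have "P \<in> carrier_mat (rep_dim G R) (rep_dim G R)" by (simp add: P_def n_def)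
  from irreducible_rep_commutant_scalar[OF R this PR] obtain z where z: "P = z \<cdot>\<^sub>m 1\<^sub>m n"
    unfolding n_def by metis
  have int: "integrable \<mu> (\<lambda>x. R x $$ (p, b) * cnj (R x $$ (p, d)))" if "p < n" for p
    using that abcd unitary_rep_continuous[OF u, folded n_def]
    by (intro integrable_continuous_map continuous_intros) auto
  have "of_nat n * z = (\<Sum>p<n. P $$ (p, p))" unfolding z by simp
  also have "\<dots> = (LINT x|\<mu>. (\<Sum>p<n. R x $$ (p, b) * cnj (R x $$ (p, d))))"
    using int by (simp add: P_def L2_inner_def)
  also have "\<dots> = (LINT x|\<mu>. (if b = d then 1 else 0))"
  proof (intro Bochner_Integration.integral_cong refl)
    fix x assume "x \<in> space \<mu>"
    then have x: "x \<in> carrier G" using space_haar by simp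
    note cR = unitary_repD(1)[OF u x, folded n_def]
    have "(mat_adjoint (R x) * R x) $$ (d, b) = (\<Sum>p<n. R x $$ (p, b) * cnj (R x $$ (p, d)))"
      using index_mat_mult_sum[OF mat_adjoint_carrier[OF cR] cR] abcd cR
      by (simp add: mult.commute)
    then show "(\<Sum>p<n. R x $$ (p, b) * cnj (R x $$ (p, d))) = (if b = d then 1 else 0)"
      using unitary_repD(2)[OF u x, folded n_def] abcd by auto
  qed
  also have "\<dots> = (if b = d then 1 else 0)" using prob_space by simp
  finally have "z = (if b = d then 1 / of_nat n else 0)"
    using n by (auto simp: field_simps split: if_splits)
  moreover have "L2_inner \<mu> (\<lambda>x. R x $$ (a, b)) (\<lambda>x. R x $$ (c, d)) = P $$ (a, c)"
    using abcd by (simp add: P_def)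
  ultimately show ?thesis using abcd unfolding z by (simp add: n_def)
qed

end

section \<open>Matrix elements in orthonormal bases\<close>

lemma cscalar_prod_sum:
  fixes x y :: "complex vec"
  assumes "x \<in> carrier_vec n" "y \<in> carrier_vec n"
  shows "x \<bullet>c y = (\<Sum>r<n. x $ r * cnj (y $ r))"
  using assms by (auto simp: scalar_prod_def lessThan_atLeast0 conjugate_complex_def intro!: sum.cong)

lemma orthonormal_vec_basis_carrier:
  "orthonormal_vec_basis n v \<Longrightarrow> i < n \<Longrightarrow> v i \<in> carrier_vec n"
  by (auto simp: orthonormal_vec_basis_def)

text \<open>Change of basis to the orthonormal system \<open>v\<close>: conjugating by this matrix
  turns the coefficients \<open><A v_j | v_i>\<close> into ordinary entries, so that matrix algebra
  applies to them.\<close>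

definition basis_mat :: "nat \<Rightarrow> (nat \<Rightarrow> complex vec) \<Rightarrow> complex mat" where
  "basis_mat n v = mat n n (\<lambda>(r, i). v i $ r)"

lemma basis_mat_carrier [simp]: "basis_mat n v \<in> carrier_mat n n"
  by (simp add: basis_mat_def)

lemma basis_mat_index [simp]: "r < n \<Longrightarrow> i < n \<Longrightarrow> basis_mat n v $$ (r, i) = v i $ r"
  by (simp add: basis_mat_def)

lemma basis_mat_dim [simp]: "dim_row (basis_mat n v) = n" "dim_col (basis_mat n v) = n"
  by (simp_all add: basis_mat_def)

text \<open>Orthonormality is the first identity; the second follows because a left inverse of a
  square matrix is also a right inverse.\<close>

lemma basis_mat_unitary:
  assumes "orthonormal_vec_basis n v"
  shows "mat_adjoint (basis_mat n v) * basis_mat n v = 1\<^sub>m n"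
    and "basis_mat n v * mat_adjoint (basis_mat n v) = 1\<^sub>m n"
proof -
  let ?U = "basis_mat n v"
  have Ua: "mat_adjoint ?U \<in> carrier_mat n n" by simp
  show *: "mat_adjoint ?U * ?U = 1\<^sub>m n"
  proof (rule eq_matI)
    fix i j assume "i < dim_row (1\<^sub>m n :: complex mat)" "j < dim_col (1\<^sub>m n :: complex mat)"
    then have ij: "i < n" "j < n" by auto
    have "(mat_adjoint ?U * ?U) $$ (i, j) = v j \<bullet>c v i"
      using ij orthonormal_vec_basis_carrier[OF assms]
      by (simp add: index_mat_mult_sum[OF Ua basis_mat_carrier ij] cscalar_prod_sum[of _ n]
          mult.commute)
    then show "(mat_adjoint ?U * ?U) $$ (i, j) = 1\<^sub>m n $$ (i, j)"
      using assms ij unfolding orthonormal_vec_basis_def by auto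
  qed auto
  show "?U * mat_adjoint ?U = 1\<^sub>m n"
    by (rule mat_mult_left_right_inverse[OF Ua basis_mat_carrier *])
qed

lemma mat_coeff_sum:
  fixes A :: "complex mat"
  assumes A: "A \<in> carrier_mat n n" and v: "v i \<in> carrier_vec n" "v j \<in> carrier_vec n"
  shows "(A *\<^sub>v v j) \<bullet>c v i = (\<Sum>(r, s)\<in>{..<n} \<times> {..<n}. cnj (v i $ r) * v j $ s * A $$ (r, s))"
proof -
  have "(A *\<^sub>v v j) \<bullet>c v i = (\<Sum>r<n. (\<Sum>s<n. A $$ (r, s) * v j $ s) * cnj (v i $ r))"
    using A v by (subst cscalar_prod_sum[of _ n])
      (auto simp: scalar_prod_def lessThan_atLeast0 intro!: sum.cong)
  also have "\<dots> = (\<Sum>r<n. \<Sum>s<n. cnj (v i $ r) * v j $ s * A $$ (r, s))"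
    by (simp add: sum_distrib_left sum_distrib_right mult_ac)
  finally show ?thesis by (simp add: sum.cartesian_product)
qed

lemma mat_coeff_basis_mat:
  fixes A :: "complex mat"
  assumes v: "orthonormal_vec_basis n v" and A: "A \<in> carrier_mat n n" and ij: "i < n" "j < n"
  shows "(A *\<^sub>v v j) \<bullet>c v i = (mat_adjoint (basis_mat n v) * A * basis_mat n v) $$ (i, j)"
proof -
  let ?U = "basis_mat n v"
  have UA: "mat_adjoint ?U * A \<in> carrier_mat n n" using A by auto
  have "(mat_adjoint ?U * A * ?U) $$ (i, j)
    = (\<Sum>s<n. (\<Sum>r<n. cnj (v i $ r) * A $$ (r, s)) * v j $ s)"
    using ij A by (simp add: index_mat_mult_sum[OF UA basis_mat_carrier ij]
        index_mat_mult_sum[OF mat_adjoint_carrier[OF basis_mat_carrier] A ij(1)]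
        del: index_mult_mat(1))
  also have "\<dots> = (\<Sum>r<n. \<Sum>s<n. cnj (v i $ r) * v j $ s * A $$ (r, s))"
    by (subst sum.swap) (simp add: sum_distrib_left sum_distrib_right mult_ac)
  also have "\<dots> = (A *\<^sub>v v j) \<bullet>c v i"
    using orthonormal_vec_basis_carrier[OF v] ij
    by (subst mat_coeff_sum[OF A]) (auto simp: sum.cartesian_product)
  finally show ?thesis ..
qed

text \<open>Insert \<open>U * adjoint U = 1\<close> between the two factors; in the new basis this
  is ordinary matrix multiplication.\<close>

lemma mat_coeff_mult:
  fixes A B :: "complex mat"
  assumes v: "orthonormal_vec_basis n v" and A: "A \<in> carrier_mat n n" and B: "B \<in> carrier_mat n n"
    and ij: "i < n" "j < n"
  shows "((A * B) *\<^sub>v v j) \<bullet>c v i = (\<Sum>q<n. ((A *\<^sub>v v q) \<bullet>c v i) * ((B *\<^sub>v v j) \<bullet>c v q))"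
proof -
  define U where "U = basis_mat n v"
  let ?V = "mat_adjoint U"
  have U: "U \<in> carrier_mat n n" "?V \<in> carrier_mat n n" by (simp_all add: U_def)
  have cancel: "U * (?V * Y) = Y" if "Y \<in> carrier_mat n n" for Y
    using that U basis_mat_unitary(2)[OF v, folded U_def]
    by (simp add: assoc_mult_mat[OF U, symmetric])
  have UAU: "?V * A * U \<in> carrier_mat n n" and UBU: "?V * B * U \<in> carrier_mat n n"
    using U A B by auto
  have "?V * (A * B) * U = (?V * A * U) * (?V * B * U)"
    using U A B by (simp add: assoc_mult_mat[of _ n n _ n _ n] mult_carrier_mat[of _ n n _ n] cancel)
  then have "((A * B) *\<^sub>v v j) \<bullet>c v i = ((?V * A * U) * (?V * B * U)) $$ (i, j)"
    using mat_coeff_basis_mat[OF v _ ij, of "A * B"] A B by (simp add: U_def)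
  also have "\<dots> = (\<Sum>q<n. (?V * A * U) $$ (i, q) * (?V * B * U) $$ (q, j))"
    by (rule index_mat_mult_sum[OF UAU UBU ij])
  finally show ?thesis
    using mat_coeff_basis_mat[OF v] A B ij by (simp add: U_def)
qed

text \<open>In \<open>A = U (adjoint U A U) adjoint U\<close> the middle factor holds the
  coefficients, and entries of the outer two multiply to entries of matrix units.\<close>

lemma mat_expand_basis:
  fixes A :: "complex mat"
  assumes v: "orthonormal_vec_basis n v" and A: "A \<in> carrier_mat n n" and rs: "r < n" "s < n"
  shows "A $$ (r, s) = (\<Sum>p<n. \<Sum>q<n. ((A *\<^sub>v v q) \<bullet>c v p) * matrix_unit n v p q $$ (r, s))"
proof -
  define U where "U = basis_mat n v"
  let ?V = "mat_adjoint U"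
  have U: "U \<in> carrier_mat n n" "?V \<in> carrier_mat n n" by (simp_all add: U_def)
  let ?C = "?V * A * U"
  have C: "?C \<in> carrier_mat n n" and UC: "U * ?C \<in> carrier_mat n n" using U A by auto
  have "U * ?C * ?V = (U * ?V) * A * (U * ?V)"
    using U A by (simp add: assoc_mult_mat[of _ n n _ n _ n] mult_carrier_mat[of _ n n _ n])
  also have "\<dots> = A" using A basis_mat_unitary(2)[OF v, folded U_def] by simp
  finally have "A $$ (r, s) = (U * ?C * ?V) $$ (r, s)" by simp
  also have "\<dots> = (\<Sum>q<n. (\<Sum>p<n. U $$ (r, p) * ?C $$ (p, q)) * ?V $$ (q, s))"
    using rs by (simp add: index_mat_mult_sum[OF UC U(2) rs]
        index_mat_mult_sum[OF U(1) C rs(1)] del: index_mult_mat(1))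
  also have "\<dots> = (\<Sum>p<n. \<Sum>q<n. ?C $$ (p, q) * (U $$ (r, p) * ?V $$ (q, s)))"
    by (subst sum.swap) (simp add: sum_distrib_left sum_distrib_right mult_ac)
  also have "\<dots> = (\<Sum>p<n. \<Sum>q<n. ((A *\<^sub>v v q) \<bullet>c v p) * matrix_unit n v p q $$ (r, s))"
    using rs mat_coeff_basis_mat[OF v A] by (simp add: matrix_unit_def U_def)
  finally show ?thesis .
qed

lemma mat_elem_mult:
  assumes R: "unitary_rep G X R" and v: "orthonormal_vec_basis (rep_dim G R) v"
    and "g \<in> carrier G" "h \<in> carrier G" "i < rep_dim G R" "j < rep_dim G R"
  shows "mat_elem R v i j (g \<otimes>\<^bsub>G\<^esub> h) = (\<Sum>q<rep_dim G R. mat_elem R v i q g * mat_elem R v q j h)"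
  unfolding mat_elem_def unitary_repD(4)[OF R assms(3,4)]
  using unitary_repD(1)[OF R] assms by (intro mat_coeff_mult) auto

lemma mat_elem_inv:
  assumes "group G" and R: "unitary_rep G X R" and v: "orthonormal_vec_basis (rep_dim G R) v"
    and g: "g \<in> carrier G" and ij: "i < rep_dim G R" "j < rep_dim G R"
  shows "mat_elem R v i j (inv\<^bsub>G\<^esub> g) = cnj (mat_elem R v j i g)"
proof -
  note c = unitary_repD(1)[OF R g]
  note vc = orthonormal_vec_basis_carrier[OF v]
  let ?S = "{..<rep_dim G R}"
  have "mat_elem R v i j (inv\<^bsub>G\<^esub> g)
    = (\<Sum>r\<in>?S. \<Sum>s\<in>?S. cnj (v i $ r) * v j $ s * cnj (R g $$ (s, r)))"
    unfolding mat_elem_def unitary_rep_inv[OF \<open>group G\<close> R g] using c ij vc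
    by (subst mat_coeff_sum[of _ "rep_dim G R"]) (auto simp flip: sum.cartesian_product)
  also have "\<dots> = cnj (mat_elem R v j i g)"
    unfolding mat_elem_def using c ij vc
    by (subst sum.swap, subst mat_coeff_sum[of _ "rep_dim G R"])
      (auto simp: cnj_sum mult_ac simp flip: sum.cartesian_product)
  finally show ?thesis .
qed

section \<open>Equivalence of representations and classes in the dual\<close>

lemma irreducible_rep_unitary: "irreducible_rep G X R \<Longrightarrow> unitary_rep G X R"
  by (simp add: irreducible_rep_def)

text \<open>Equality of dimensions is hidden in \<open>invertible_mat\<close>; after that the
  inverse matrix intertwines in the other direction.\<close>

lemma equivalent_reps_sym:
  assumes R: "unitary_rep G X R" and S: "unitary_rep G X S" and "equivalent_reps G R S"
  shows "equivalent_reps G S R"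
proof -
  obtain P where P: "P \<in> carrier_mat (rep_dim G S) (rep_dim G R)" "invertible_mat P"
    and PR: "\<And>g. g \<in> carrier G \<Longrightarrow> P * R g = S g * P"
    using assms(3) unfolding equivalent_reps_def by auto
  define n where "n = rep_dim G R"
  have n: "rep_dim G S = n" using P unfolding invertible_mat_def n_def by auto
  note P' = P(1)[unfolded n, folded n_def]
  obtain Q where Qc: "Q \<in> carrier_mat n n" and PQ: "P * Q = 1\<^sub>m n" "Q * P = 1\<^sub>m n"
    using invertible_matE[OF P(2) P'] .
  have "Q * S g = R g * Q" if g: "g \<in> carrier G" for g
  proof -
    have c: "R g \<in> carrier_mat n n" "S g \<in> carrier_mat n n"
      using unitary_repD(1)[OF R g] unitary_repD(1)[OF S g] n n_def by auto
    have "Q * S g = Q * S g * (P * Q)" using c Qc PQ by simp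
    also have "\<dots> = Q * (S g * P) * Q"
      using c P' Qc by (simp add: assoc_mult_mat[of _ n n _ n _ n])
    also have "\<dots> = Q * P * R g * Q"
      using c P' Qc by (simp add: assoc_mult_mat[of _ n n _ n _ n] flip: PR[OF g])
    also have "\<dots> = R g * Q" using c PQ by simp
    finally show ?thesis .
  qed
  moreover have "invertible_mat Q" by (rule invertible_matI[OF Qc P' PQ(2,1)])
  moreover have "Q \<in> carrier_mat (rep_dim G R) (rep_dim G S)"
    using Qc unfolding n n_def .
  ultimately show ?thesis unfolding equivalent_reps_def by blast
qed

lemma equivalent_reps_trans:
  assumes R: "unitary_rep G X R" and S: "unitary_rep G X S" and T: "unitary_rep G X T"
    and "equivalent_reps G R S" "equivalent_reps G S T"
  shows "equivalent_reps G R T"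
proof -
  define n where "n = rep_dim G R"
  obtain P where P: "P \<in> carrier_mat (rep_dim G S) n" "invertible_mat P"
    and PR: "\<And>g. g \<in> carrier G \<Longrightarrow> P * R g = S g * P"
    using assms(4) unfolding equivalent_reps_def n_def by auto
  obtain Q where Q: "Q \<in> carrier_mat (rep_dim G T) (rep_dim G S)" "invertible_mat Q"
    and QS: "\<And>g. g \<in> carrier G \<Longrightarrow> Q * S g = T g * Q"
    using assms(5) unfolding equivalent_reps_def by auto
  have n: "rep_dim G S = n" "rep_dim G T = n"
    using P Q unfolding invertible_mat_def by auto
  note P' = P(1)[unfolded n] and Q' = Q(1)[unfolded n]
  have "(Q * P) * R g = T g * (Q * P)" if g: "g \<in> carrier G" for g
  proof -
    have c: "R g \<in> carrier_mat n n" "S g \<in> carrier_mat n n" "T g \<in> carrier_mat n n"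
      using unitary_repD(1)[OF R g] unitary_repD(1)[OF S g] unitary_repD(1)[OF T g] n n_def by auto
    have "(Q * P) * R g = Q * S g * P"
      using c P' Q' PR[OF g] by (simp add: assoc_mult_mat[of _ n n _ n _ n])
    also have "\<dots> = T g * (Q * P)"
      using c P' Q' QS[OF g] by (simp add: assoc_mult_mat[of _ n n _ n _ n])
    finally show ?thesis .
  qed
  moreover have "invertible_mat (Q * P)"
  proof -
    obtain P1 Q1 where inv: "P1 \<in> carrier_mat n n" "P * P1 = 1\<^sub>m n" "P1 * P = 1\<^sub>m n"
        "Q1 \<in> carrier_mat n n" "Q * Q1 = 1\<^sub>m n" "Q1 * Q = 1\<^sub>m n"
      using invertible_matE[OF P(2) P'] invertible_matE[OF Q(2) Q'] by metis
    have "(Q * P) * (P1 * Q1) = Q * (P * P1) * Q1" "(P1 * Q1) * (Q * P) = P1 * (Q1 * Q) * P"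
      using inv(1,4) P' Q'
      by (simp_all add: assoc_mult_mat[of _ n n _ n _ n] mult_carrier_mat[of _ n n _ n])
    then show ?thesis
      using inv P' Q' by (intro invertible_matI[of _ n "P1 * Q1"]) auto
  qed
  moreover have "Q * P \<in> carrier_mat (rep_dim G T) (rep_dim G R)"
    using mult_carrier_mat[OF Q' P'] unfolding n n_def .
  ultimately show ?thesis unfolding equivalent_reps_def by blast
qed

lemma unitary_dual_irreducible:
  "\<rho> \<in> unitary_dual G X \<Longrightarrow> R \<in> \<rho> \<Longrightarrow> irreducible_rep G X R"
  unfolding unitary_dual_def quotient_def by blast

text \<open>Meant for use in contrapositive form: representatives of different classes are
  inequivalent, which is what the vanishing half of Schur orthogonality asks for.\<close>

lemma unitary_dual_eqI:
  assumes "\<rho> \<in> unitary_dual G X" "\<tau> \<in> unitary_dual G X" "R \<in> \<rho>" "S \<in> \<tau>"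
    and RS: "equivalent_reps G R S"
  shows "\<rho> = \<tau>"
proof -
  define E where
    "E = {(R, S). irreducible_rep G X R \<and> irreducible_rep G X S \<and> equivalent_reps G R S}"
  have sym: "(B, A) \<in> E" if "(A, B) \<in> E" for A B
    using that equivalent_reps_sym[of G X A B] irreducible_rep_unitary unfolding E_def by blast
  have trans: "(A, C) \<in> E" if "(A, B) \<in> E" "(B, C) \<in> E" for A B C
    using that equivalent_reps_trans[of G X A B C] irreducible_rep_unitary unfolding E_def by blast
  obtain A where A: "\<rho> = E `` {A}"
    using assms(1) unfolding unitary_dual_def E_def quotient_def by blast
  obtain B where B: "\<tau> = E `` {B}"
    using assms(2) unfolding unitary_dual_def E_def quotient_def by blast
  have "(R, S) \<in> E"
    using RS assms(1-4) unitary_dual_irreducible unfolding E_def by blast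
  then have "(A, B) \<in> E" using assms(3,4) A B sym trans by blast
  then show ?thesis using A B sym trans by blast
qed

section \<open>Orthogonality of matrix elements in the chosen bases\<close>

context compact_group_haar
begin

text \<open>One sum over pairs instead of a double sum: this is the shape in which
  \<open>L2_inner_lincomb\<close> expands both arguments at once.\<close>

lemma mat_elem_sum:
  assumes "unitary_rep G X R" "orthonormal_vec_basis (rep_dim G R) v" "x \<in> carrier G"
    "i < rep_dim G R" "j < rep_dim G R"
  shows "mat_elem R v i j x = (\<Sum>p\<in>{..<rep_dim G R} \<times> {..<rep_dim G R}.
    (cnj (v i $ fst p) * v j $ snd p) * R x $$ (fst p, snd p))"
  unfolding mat_elem_def
  using unitary_repD(1)[OF assms(1,3)] orthonormal_vec_basis_carrier[OF assms(2)] assms(4,5)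
  by (subst mat_coeff_sum[of _ "rep_dim G R"]) (auto simp: case_prod_unfold)

lemma mat_elem_continuous:
  assumes "unitary_rep G X R" "orthonormal_vec_basis (rep_dim G R) v"
    "i < rep_dim G R" "j < rep_dim G R"
  shows "continuous_map X euclidean (mat_elem R v i j)"
proof (rule continuous_map_eq)
  show "continuous_map X euclidean (\<lambda>x. \<Sum>p\<in>{..<rep_dim G R} \<times> {..<rep_dim G R}.
    (cnj (v i $ fst p) * v j $ snd p) * R x $$ (fst p, snd p))"
    using unitary_rep_continuous[OF assms(1)] by (intro continuous_intros) auto
qed (use mat_elem_sum[OF assms(1,2) _ assms(3,4)] topspace_eq in auto)

lemma L2_inner_mat_elem_sum:
  assumes R: "unitary_rep G X R" and v: "orthonormal_vec_basis (rep_dim G R) v"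
    and S: "unitary_rep G X S" and w: "orthonormal_vec_basis (rep_dim G S) w"
    and "i < rep_dim G R" "j < rep_dim G R" "k < rep_dim G S" "l < rep_dim G S"
  shows "L2_inner \<mu> (mat_elem R v i j) (mat_elem S w k l)
    = (\<Sum>p\<in>{..<rep_dim G R} \<times> {..<rep_dim G R}. \<Sum>q\<in>{..<rep_dim G S} \<times> {..<rep_dim G S}.
        (cnj (v i $ fst p) * v j $ snd p) * cnj (cnj (w k $ fst q) * w l $ snd q) *
        L2_inner \<mu> (\<lambda>x. R x $$ (fst p, snd p)) (\<lambda>x. S x $$ (fst q, snd q)))"
  by (subst L2_inner_lincomb[symmetric])
    (use assms unitary_rep_continuous[OF R] unitary_rep_continuous[OF S] mat_elem_sum space_haar
     in \<open>auto intro!: L2_inner_cong\<close>)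

lemma mat_elem_orthogonality_inequivalent:
  assumes R: "irreducible_rep G X R" and v: "orthonormal_vec_basis (rep_dim G R) v"
    and S: "irreducible_rep G X S" and w: "orthonormal_vec_basis (rep_dim G S) w"
    and "\<not> equivalent_reps G S R"
    and "i < rep_dim G R" "j < rep_dim G R" "k < rep_dim G S" "l < rep_dim G S"
  shows "L2_inner \<mu> (mat_elem R v i j) (mat_elem S w k l) = 0"
proof -
  have u: "unitary_rep G X R" "unitary_rep G X S"
    using R S unfolding irreducible_rep_def by auto
  show ?thesis
    unfolding L2_inner_mat_elem_sum[OF u(1) v u(2) w assms(6-9)]
    using schur_orthogonality_inequivalent[OF S R assms(5)] by (auto intro!: sum.neutral)
qed

lemma mat_elem_orthogonality:
  assumes R: "irreducible_rep G X R" and v: "orthonormal_vec_basis (rep_dim G R) v"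
    and ijkl: "i < rep_dim G R" "j < rep_dim G R" "k < rep_dim G R" "l < rep_dim G R"
  shows "L2_inner \<mu> (mat_elem R v i j) (mat_elem R v k l)
    = (if i = k \<and> j = l then 1 / of_nat (rep_dim G R) else 0)"
proof -
  define n where "n = rep_dim G R"
  note v = v[folded n_def] and ijkl = ijkl[folded n_def]
  have u: "unitary_rep G X R" using R unfolding irreducible_rep_def by auto
  let ?N = "{..<n} \<times> {..<n}"
  have "L2_inner \<mu> (mat_elem R v i j) (mat_elem R v k l)
    = (\<Sum>p\<in>?N. \<Sum>q\<in>?N.
        (cnj (v i $ fst p) * v j $ snd p) * cnj (cnj (v k $ fst q) * v l $ snd q) *
        L2_inner \<mu> (\<lambda>x. R x $$ (fst p, snd p)) (\<lambda>x. R x $$ (fst q, snd q)))"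
    using L2_inner_mat_elem_sum[OF u _ u] v ijkl by (simp only: n_def)
  also have "\<dots> = (\<Sum>p\<in>?N. \<Sum>q\<in>?N. if q = p then
        (cnj (v i $ fst p) * v j $ snd p) * (v k $ fst p * cnj (v l $ snd p)) / of_nat n else 0)"
  proof (intro sum.cong refl)
    fix p q assume "p \<in> ?N" "q \<in> ?N"
    then have "L2_inner \<mu> (\<lambda>x. R x $$ (fst p, snd p)) (\<lambda>x. R x $$ (fst q, snd q))
      = (if q = p then 1 / of_nat n else 0)"
      using schur_orthogonality[OF R, of "fst p" "snd p" "fst q" "snd q"]
      by (auto simp: n_def prod_eq_iff)
    then show "(cnj (v i $ fst p) * v j $ snd p) * cnj (cnj (v k $ fst q) * v l $ snd q) *
        L2_inner \<mu> (\<lambda>x. R x $$ (fst p, snd p)) (\<lambda>x. R x $$ (fst q, snd q))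
      = (if q = p then
        (cnj (v i $ fst p) * v j $ snd p) * (v k $ fst p * cnj (v l $ snd p)) / of_nat n else 0)"
      by simp
  qed
  also have "\<dots> = (\<Sum>p\<in>?N. (cnj (v i $ fst p) * v j $ snd p) *
      (v k $ fst p * cnj (v l $ snd p)) / of_nat n)"
    by (intro sum.cong refl) (subst sum.delta, auto)
  \<comment> \<open>Orthogonality of entries has collapsed one of the two sums over pairs. What
    remains factors into a row part, pairing \<open>v k\<close> with \<open>v i\<close>, and a
    column part, pairing \<open>v j\<close> with \<open>v l\<close>.\<close>
  also have "\<dots> = (\<Sum>r<n. \<Sum>s<n. (v k $ r * cnj (v i $ r)) * (v j $ s * cnj (v l $ s))) / of_nat n"
    by (simp add: sum.cartesian_product sum_divide_distrib case_prod_unfold mult_ac)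
  also have "\<dots> = (v k \<bullet>c v i) * (v j \<bullet>c v l) / of_nat n"
    using ijkl orthonormal_vec_basis_carrier[OF v]
    by (simp add: cscalar_prod_sum[of _ n] sum_product)
  also have "\<dots> = (if i = k \<and> j = l then 1 / of_nat n else 0)"
    using v ijkl unfolding orthonormal_vec_basis_def by auto
  finally show ?thesis by (simp add: n_def)
qed

lemma unitary_dual_orthogonality:
  assumes T: "\<And>\<rho>. \<rho> \<in> unitary_dual G X \<Longrightarrow> T \<rho> \<in> \<rho>"
    and b: "\<And>\<rho>. \<rho> \<in> unitary_dual G X \<Longrightarrow> orthonormal_vec_basis (rep_dim G (T \<rho>)) (b \<rho>)"
    and \<rho>: "\<rho> \<in> unitary_dual G X" and \<tau>: "\<tau> \<in> unitary_dual G X"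
    and "i < rep_dim G (T \<rho>)" "j < rep_dim G (T \<rho>)" "k < rep_dim G (T \<tau>)" "l < rep_dim G (T \<tau>)"
  shows "L2_inner \<mu> (mat_elem (T \<rho>) (b \<rho>) i j) (mat_elem (T \<tau>) (b \<tau>) k l)
    = (if \<rho> = \<tau> \<and> i = k \<and> j = l then 1 / of_nat (rep_dim G (T \<rho>)) else 0)"
proof (cases "\<rho> = \<tau>")
  case True
  then show ?thesis
    using mat_elem_orthogonality[OF unitary_dual_irreducible[OF \<rho> T[OF \<rho>]] b[OF \<rho>]] assms(5-8)
    by simp
next
  case False
  then have "\<not> equivalent_reps G (T \<tau>) (T \<rho>)"
    using unitary_dual_eqI[OF \<tau> \<rho> T[OF \<tau>] T[OF \<rho>]] by blast
  then show ?thesis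
    using mat_elem_orthogonality_inequivalent[OF unitary_dual_irreducible[OF \<rho> T[OF \<rho>]] b[OF \<rho>]
        unitary_dual_irreducible[OF \<tau> T[OF \<tau>]] b[OF \<tau>]] assms(5-8) False
    by simp
qed

end

section \<open>Integrals with values in $L^2$\<close>

lemma L2_norm_cong:
  "(\<And>x. x \<in> space \<mu> \<Longrightarrow> f x = f' x) \<Longrightarrow> L2_norm \<mu> f = L2_norm \<mu> f'"
  unfolding L2_norm_def by (intro arg_cong[of _ _ sqrt] Bochner_Integration.integral_cong) auto

lemma L2_cong:
  assumes "\<And>x. x \<in> space \<mu> \<Longrightarrow> f x = f' x"
  shows "f \<in> L2 \<mu> \<longleftrightarrow> f' \<in> L2 \<mu>"
  unfolding L2_def mem_Collect_eq using assms
  by (intro arg_cong2[of _ _ _ _ "(\<and>)"] measurable_cong Bochner_Integration.integrable_cong) auto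

lemma L2_cmult: "f \<in> L2 \<mu> \<Longrightarrow> (\<lambda>x. c * f x) \<in> L2 \<mu>"
  unfolding L2_def by (auto simp: norm_mult power_mult_distrib)

lemma L2_add:
  assumes "f \<in> L2 \<mu>" "h \<in> L2 \<mu>"
  shows "(\<lambda>x. f x + h x) \<in> L2 \<mu>"
proof -
  have [measurable]: "f \<in> borel_measurable \<mu>" "h \<in> borel_measurable \<mu>"
    and int: "integrable \<mu> (\<lambda>x. (norm (f x))\<^sup>2)" "integrable \<mu> (\<lambda>x. (norm (h x))\<^sup>2)"
    using assms unfolding L2_def by auto
  have "integrable \<mu> (\<lambda>x. (norm (f x + h x))\<^sup>2)"
  proof (rule Bochner_Integration.integrable_bound)
    show "integrable \<mu> (\<lambda>x. 2 * (norm (f x))\<^sup>2 + 2 * (norm (h x))\<^sup>2)" using int by simp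
    show "AE x in \<mu>. norm ((norm (f x + h x))\<^sup>2) \<le> norm (2 * (norm (f x))\<^sup>2 + 2 * (norm (h x))\<^sup>2)"
    proof (rule AE_I2)
      fix x
      have "(norm (f x + h x))\<^sup>2 \<le> (norm (f x) + norm (h x))\<^sup>2"
        by (intro power_mono norm_triangle_ineq) auto
      also have "\<dots> \<le> 2 * (norm (f x))\<^sup>2 + 2 * (norm (h x))\<^sup>2"
        using sum_squares_bound[of "norm (f x)" "norm (h x)"] by (simp add: power2_sum)
      finally show "norm ((norm (f x + h x))\<^sup>2) \<le> norm (2 * (norm (f x))\<^sup>2 + 2 * (norm (h x))\<^sup>2)"
        by simp
    qed
  qed simp
  then show ?thesis unfolding L2_def by simp
qed

lemma L2_diff:
  assumes "f \<in> L2 \<mu>" "h \<in> L2 \<mu>"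
  shows "(\<lambda>x. f x - h x) \<in> L2 \<mu>"
  using L2_add[OF assms(1) L2_cmult[OF assms(2), of "-1"]] by simp

lemma L2_sum:
  assumes "\<And>i. i \<in> I \<Longrightarrow> f i \<in> L2 \<mu>"
  shows "(\<lambda>x. \<Sum>i\<in>I. f i x) \<in> L2 \<mu>"
  using assms
proof (induction I rule: infinite_finite_induct)
  case (insert i I)
  then show ?case using L2_add[of "f i" \<mu> "\<lambda>x. \<Sum>i\<in>I. f i x"] by simp
qed (simp_all add: L2_def)

lemma borel_measurable_cnj:
  "f \<in> borel_measurable M \<Longrightarrow> (\<lambda>x. cnj (f x)) \<in> borel_measurable M"
  by (rule borel_measurable_continuous_on[OF continuous_on_cnj[OF continuous_on_id]])

text \<open>\<open>s\<close> may take values in any type, in particular in functions. With \<phi> an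
  inner product against a fixed function, or the evaluation at a point, the right-hand side is what
  \<open>simple_L2_integral\<close> becomes after pairing or evaluation.\<close>

lemma (in finite_measure) simple_function_image_integral:
  fixes \<phi> :: "'b \<Rightarrow> complex"
  assumes s: "simple_function M s"
  shows "integrable M (\<lambda>x. \<phi> (s x))"
    and "(LINT x|M. \<phi> (s x)) = (\<Sum>h\<in>s ` space M. of_real (measure M {x \<in> space M. s x = h}) * \<phi> h)"
proof -
  let ?A = "\<lambda>h. {x \<in> space M. s x = h}"
  have fin: "finite (s ` space M)" using s by (rule simple_functionD)
  have meas: "?A h \<in> sets M" for h
  proof -
    have "s -` {h} \<inter> space M = ?A h" by auto
    then show ?thesis using simple_functionD(2)[OF s, of "{h}"] by simp
  qed
  have eq: "\<phi> (s x) = (\<Sum>h\<in>s ` space M. indicator (?A h) x *\<^sub>R \<phi> h)" if "x \<in> space M" for x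
  proof -
    have "(\<Sum>h\<in>s ` space M. indicator (?A h) x *\<^sub>R \<phi> h) = (\<Sum>h\<in>s ` space M. if s x = h then \<phi> h else 0)"
      using that by (intro sum.cong) (auto simp: indicator_def)
    then show ?thesis using that fin by simp
  qed
  have int: "integrable M (\<lambda>x. indicator (?A h) x *\<^sub>R \<phi> h)" for h
    using meas by (intro integrable_scaleR_left) (simp add: emeasure_eq_measure)
  have "integrable M (\<lambda>x. \<Sum>h\<in>s ` space M. indicator (?A h) x *\<^sub>R \<phi> h)"
    using int by (rule Bochner_Integration.integrable_sum)
  then show "integrable M (\<lambda>x. \<phi> (s x))"
    using eq by (subst Bochner_Integration.integrable_cong[OF refl eq])
  have "(LINT x|M. \<phi> (s x)) = (LINT x|M. (\<Sum>h\<in>s ` space M. indicator (?A h) x *\<^sub>R \<phi> h))"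
    by (rule Bochner_Integration.integral_cong[OF refl eq])
  also have "\<dots> = (\<Sum>h\<in>s ` space M. LINT x|M. indicator (?A h) x *\<^sub>R \<phi> h)"
    using int by (rule Bochner_Integration.integral_sum)
  also have "\<dots> = (\<Sum>h\<in>s ` space M. of_real (measure M (?A h)) * \<phi> h)"
  proof (intro sum.cong refl)
    fix h
    have "(LINT x|M. indicator (?A h) x *\<^sub>R \<phi> h) = measure M (?A h) *\<^sub>R \<phi> h"
      using meas[of h] sets.sets_into_space[OF meas[of h]]
      by (subst integral_scaleR_left) (auto simp: emeasure_eq_measure Int_absorb2)
    then show "(LINT x|M. indicator (?A h) x *\<^sub>R \<phi> h) = of_real (measure M (?A h)) * \<phi> h"
      by (simp add: scaleR_conv_of_real)
  qed
  finally show "(LINT x|M. \<phi> (s x)) = (\<Sum>h\<in>s ` space M. of_real (measure M (?A h)) * \<phi> h)" .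
qed

text \<open>The values are functions of y, so simplicity is built up by composing with the map that
  adds one more term \<open>z * h q y\<close>.\<close>

lemma simple_function_lincomb:
  fixes S :: "'q \<Rightarrow> 'a \<Rightarrow> complex"
  assumes "finite Q" "\<And>q. q \<in> Q \<Longrightarrow> simple_function M (S q)"
  shows "simple_function M (\<lambda>x y. \<Sum>q\<in>Q. S q x * h q y)"
  using assms
proof (induction Q rule: finite_induct)
  case (insert q Q)
  then have "simple_function M (\<lambda>x. (\<lambda>z f y. z * h q y + f y) (S q x) (\<lambda>y. \<Sum>q\<in>Q. S q x * h q y))"
    by (intro simple_function_compose2[where h = "\<lambda>z f y. z * h q y + f y"]) auto
  then show ?case using insert by simp
qed simp

section \<open>Pairings with bounded functions on a probability space\<close>

context prob_space
begin

lemma L2_integrable: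
  assumes "f \<in> L2 M"
  shows "integrable M f"
proof (rule Bochner_Integration.integrable_bound)
  show "integrable M (\<lambda>x. 1 + (norm (f x))\<^sup>2)" "f \<in> borel_measurable M"
    using assms unfolding L2_def by auto
  have "r \<le> 1 + r\<^sup>2" for r :: real
    using sum_squares_bound[of r 1] zero_le_power2[of r] unfolding power_one mult_1_right by linarith
  then show "AE x in M. norm (f x) \<le> norm (1 + (norm (f x))\<^sup>2)"
    by (intro AE_I2) (simp add: abs_of_nonneg)
qed

text \<open>The variance of \<open>norm f\<close> is non-negative; this is Cauchy-Schwarz against
  the constant 1.\<close>

lemma integral_norm_le_L2_norm:
  assumes "f \<in> L2 M"
  shows "(LINT x|M. norm (f x)) \<le> L2_norm M f"
proof -
  have "integrable M (\<lambda>x. norm (f x))" "integrable M (\<lambda>x. (norm (f x))\<^sup>2)"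
    using L2_integrable[OF assms] assms unfolding L2_def by auto
  then have "0 \<le> (LINT x|M. (norm (f x))\<^sup>2) - (LINT x|M. norm (f x))\<^sup>2"
    using variance_eq variance_positive by metis
  then show ?thesis unfolding L2_norm_def by (simp add: real_le_rsqrt)
qed

lemma L2_mult_bounded_integrable:
  assumes f: "f \<in> L2 M" and h: "h \<in> borel_measurable M" "\<And>x. x \<in> space M \<Longrightarrow> norm (h x) \<le> B"
  shows "integrable M (\<lambda>x. f x * cnj (h x))"
proof (rule Bochner_Integration.integrable_bound)
  show "integrable M (\<lambda>x. B * norm (f x))" using L2_integrable[OF f] by simp
  show "(\<lambda>x. f x * cnj (h x)) \<in> borel_measurable M"
    using f h(1) unfolding L2_def by (auto intro!: borel_measurable_times borel_measurable_cnj)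
  show "AE x in M. norm (f x * cnj (h x)) \<le> norm (B * norm (f x))"
  proof (rule AE_I2)
    fix x assume "x \<in> space M"
    then have "norm (h x) \<le> \<bar>B\<bar>" using h(2) by force
    from mult_right_mono[OF this norm_ge_zero[of "f x"]]
    show "norm (f x * cnj (h x)) \<le> norm (B * norm (f x))"
      by (simp add: norm_mult abs_mult mult.commute)
  qed
qed

text \<open>For bounded \<open>h\<close> the pairing is controlled by the mean of
  \<open>norm f\<close>, hence by the L2 norm. The test functions of interest are continuous on a
  compact space and thus bounded.\<close>

lemma norm_L2_inner_le:
  assumes f: "f \<in> L2 M" and h: "h \<in> borel_measurable M" "\<And>x. x \<in> space M \<Longrightarrow> norm (h x) \<le> B"
  shows "norm (L2_inner M f h) \<le> B * L2_norm M f"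
proof -
  have "B \<ge> 0" using h(2) not_empty norm_ge_zero order_trans by blast
  have "norm (L2_inner M f h) \<le> (LINT x|M. norm (f x * cnj (h x)))"
    unfolding L2_inner_def by (rule integral_norm_bound)
  also have "\<dots> \<le> (LINT x|M. B * norm (f x))"
  proof (rule integral_mono)
    show "norm (f x * cnj (h x)) \<le> B * norm (f x)" if "x \<in> space M" for x
      using mult_right_mono[OF h(2)[OF that], of "norm (f x)"] by (simp add: norm_mult mult.commute)
  qed (use L2_mult_bounded_integrable[OF assms] L2_integrable[OF f] in auto)
  also have "\<dots> \<le> B * L2_norm M f"
    using integral_norm_le_L2_norm[OF f] \<open>B \<ge> 0\<close> by (simp add: mult_left_mono)
  finally show ?thesis .
qed

lemma has_L2_integral_inner:
  assumes I: "has_L2_integral M F I"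
    and h: "h \<in> borel_measurable M" "\<And>x. x \<in> space M \<Longrightarrow> norm (h x) \<le> B"
    and F: "integrable M (\<lambda>x. L2_inner M (F x) h)"
  shows "L2_inner M I h = (LINT x|M. L2_inner M (F x) h)"
proof -
  note int = L2_mult_bounded_integrable[OF _ h]
  obtain s where s: "\<And>n. simple_function M (s n)" "\<And>n x. x \<in> space M \<Longrightarrow> s n x \<in> L2 M"
    and intn: "\<And>n. integrable M (\<lambda>x. L2_norm M (\<lambda>y. F x y - s n x y))"
    and lim: "(\<lambda>n. LINT x|M. L2_norm M (\<lambda>y. F x y - s n x y)) \<longlonglongrightarrow> 0"
      "(\<lambda>n. L2_norm M (\<lambda>y. I y - simple_L2_integral M (s n) y)) \<longlonglongrightarrow> 0"
    and FL2: "\<And>x. x \<in> space M \<Longrightarrow> F x \<in> L2 M" and IL2: "I \<in> L2 M"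
    using I unfolding has_L2_integral_def by auto
  let ?J = "\<lambda>n. simple_L2_integral M (s n)"
  have diff: "L2_inner M (\<lambda>y. f y - f' y) h = L2_inner M f h - L2_inner M f' h"
    if "f \<in> L2 M" "f' \<in> L2 M" for f f'
    unfolding L2_inner_def using int[OF that(1)] int[OF that(2)]
    by (simp add: left_diff_distrib)
  have J: "?J n \<in> L2 M" for n
    unfolding simple_L2_integral_def using s(2) by (intro L2_sum L2_cmult) auto
  have Jh: "L2_inner M (?J n) h = (LINT x|M. L2_inner M (s n x) h)" for n
  proof -
    have "L2_inner M (?J n) h = (LINT y|M. (\<Sum>f\<in>s n ` space M.
        of_real (measure M {x \<in> space M. s n x = f}) * (f y * cnj (h y))))"
      unfolding L2_inner_def simple_L2_integral_def by (simp add: sum_distrib_right mult.assoc)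
    also have "\<dots> = (\<Sum>f\<in>s n ` space M. of_real (measure M {x \<in> space M. s n x = f}) * L2_inner M f h)"
      unfolding L2_inner_def using int s(2) by (subst Bochner_Integration.integral_sum) auto
    also have "\<dots> = (LINT x|M. L2_inner M (s n x) h)"
      using simple_function_image_integral(2)[OF s(1), where \<phi> = "\<lambda>f. L2_inner M f h"] by simp
    finally show ?thesis .
  qed
  \<comment> \<open>\<open>?e n\<close> is the error made by the approximant \<open>s n\<close>: the
    distance of \<open>I\<close> from the integral of \<open>s n\<close>, plus the mean distance of
    \<open>F\<close> from \<open>s n\<close>, each scaled by the bound \<open>B\<close> on
    \<open>h\<close>.\<close>
  let ?e = "\<lambda>n. B * L2_norm M (\<lambda>y. I y - ?J n y) + B * (LINT x|M. L2_norm M (\<lambda>y. F x y - s n x y))"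
  have "norm (L2_inner M I h - (LINT x|M. L2_inner M (F x) h)) \<le> ?e n" for n
  proof -
    have "norm (L2_inner M I h - L2_inner M (?J n) h) \<le> B * L2_norm M (\<lambda>y. I y - ?J n y)"
      using norm_L2_inner_le[OF L2_diff[OF IL2 J] h] diff[OF IL2 J] by simp
    moreover have "norm ((LINT x|M. L2_inner M (s n x) h) - (LINT x|M. L2_inner M (F x) h))
      \<le> B * (LINT x|M. L2_norm M (\<lambda>y. F x y - s n x y))"
    proof -
      have si: "integrable M (\<lambda>x. L2_inner M (s n x) h)"
        using simple_function_image_integral(1)[OF s(1), where \<phi> = "\<lambda>f. L2_inner M f h"] by simp
      have "norm ((LINT x|M. L2_inner M (F x) h) - (LINT x|M. L2_inner M (s n x) h))
        = norm (LINT x|M. L2_inner M (F x) h - L2_inner M (s n x) h)"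
        using si F by simp
      also have "\<dots> \<le> (LINT x|M. norm (L2_inner M (F x) h - L2_inner M (s n x) h))"
        by (rule integral_norm_bound)
      also have "\<dots> \<le> (LINT x|M. B * L2_norm M (\<lambda>y. F x y - s n x y))"
      proof (rule integral_mono)
        fix x assume x: "x \<in> space M"
        show "norm (L2_inner M (F x) h - L2_inner M (s n x) h) \<le> B * L2_norm M (\<lambda>y. F x y - s n x y)"
          using norm_L2_inner_le[OF L2_diff[OF FL2[OF x] s(2)[OF x]] h]
            diff[OF FL2[OF x] s(2)[OF x]] by simp
      qed (use si F intn in auto)
      finally show ?thesis by (simp add: norm_minus_commute)
    qed
    moreover have "norm (L2_inner M I h - (LINT x|M. L2_inner M (F x) h))
      \<le> norm (L2_inner M I h - L2_inner M (?J n) h)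
        + norm ((LINT x|M. L2_inner M (s n x) h) - (LINT x|M. L2_inner M (F x) h))"
      unfolding Jh
      using norm_triangle_ineq[of "L2_inner M I h - (LINT x|M. L2_inner M (s n x) h)"
          "(LINT x|M. L2_inner M (s n x) h) - (LINT x|M. L2_inner M (F x) h)"] by simp
    ultimately show ?thesis by simp
  qed
  moreover have "?e \<longlonglongrightarrow> B * 0 + B * 0" by (intro tendsto_intros lim)
  ultimately have "norm (L2_inner M I h - (LINT x|M. L2_inner M (F x) h)) \<le> B * 0 + B * 0"
    by (intro LIMSEQ_le_const) auto
  then show ?thesis by simp
qed

end

section \<open>Integrands with values in a finite-dimensional space\<close>

context compact_group_haar
begin

text \<open>Through the Gram matrix of the \<open>h q\<close>, the norm becomes an explicit function
  of the coefficients. Measurability, bounds and limits in the coefficients are read off from this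
  form.\<close>

lemma L2_norm_lincomb:
  assumes "\<And>q. q \<in> Q \<Longrightarrow> continuous_map X euclidean (h q)"
  shows "L2_norm \<mu> (\<lambda>y. \<Sum>q\<in>Q. c q * h q y)
    = sqrt (Re (\<Sum>p\<in>Q. \<Sum>q\<in>Q. c p * cnj (c q) * L2_inner \<mu> (h p) (h q)))"
proof -
  let ?f = "\<lambda>y. \<Sum>q\<in>Q. c q * h q y"
  have "L2_inner \<mu> ?f ?f = (LINT y|\<mu>. of_real ((norm (?f y))\<^sup>2))"
    unfolding L2_inner_def by (simp only: complex_norm_square)
  also have "\<dots> = of_real (LINT y|\<mu>. (norm (?f y))\<^sup>2)" by (rule integral_complex_of_real)
  finally have "Re (L2_inner \<mu> ?f ?f) = (LINT y|\<mu>. (norm (?f y))\<^sup>2)" by simp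
  moreover have "L2_inner \<mu> ?f ?f = (\<Sum>p\<in>Q. \<Sum>q\<in>Q. c p * cnj (c q) * L2_inner \<mu> (h p) (h q))"
    using assms by (intro L2_inner_lincomb)
  ultimately show ?thesis unfolding L2_norm_def by (simp only:)
qed

text \<open>Approximation happens on the scalar coefficients: each \<open>a q\<close> is a pointwise
  limit of simple functions, and recombining these with the fixed \<open>h q\<close> gives simple
  functions with values in the span. Dominated convergence, applied to the norm of the error and to
  the coefficients themselves, yields the two limits in \<open>has_L2_integral\<close>.\<close>

lemma has_L2_integral_finite_rank:
  assumes Q: "finite Q"
    and h: "\<And>q. q \<in> Q \<Longrightarrow> continuous_map X euclidean (h q)"
    and a: "\<And>q. q \<in> Q \<Longrightarrow> continuous_map X euclidean (a q)"
    and F: "\<And>x y. x \<in> carrier G \<Longrightarrow> y \<in> carrier G \<Longrightarrow> F x y = (\<Sum>q\<in>Q. a q x * h q y)"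
  shows "has_L2_integral \<mu> F (\<lambda>y. \<Sum>q\<in>Q. (LINT x|\<mu>. a q x) * h q y)"
proof -
  have hL2: "(\<lambda>y. \<Sum>q\<in>Q. c q * h q y) \<in> L2 \<mu>" for c
    using h by (intro L2_sum L2_cmult continuous_map_L2)
  define N where "N c = L2_norm \<mu> (\<lambda>y. \<Sum>q\<in>Q. c q * h q y)" for c
  have N_eq: "N c = sqrt (Re (\<Sum>p\<in>Q. \<Sum>q\<in>Q. c p * cnj (c q) * L2_inner \<mu> (h p) (h q)))" for c
    unfolding N_def using h by (rule L2_norm_lincomb)
  \<comment> \<open>A crude bound by absolute values; it supplies the constant majorant
    \<open>?b\<close> for dominated convergence.\<close>
  have N_le: "N c \<le> sqrt (\<Sum>p\<in>Q. \<Sum>q\<in>Q. C * C * norm (L2_inner \<mu> (h p) (h q)))"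
    if c: "\<And>q. q \<in> Q \<Longrightarrow> norm (c q) \<le> C" for c C
  proof -
    have "Re (\<Sum>p\<in>Q. \<Sum>q\<in>Q. c p * cnj (c q) * L2_inner \<mu> (h p) (h q))
      \<le> norm (\<Sum>p\<in>Q. \<Sum>q\<in>Q. c p * cnj (c q) * L2_inner \<mu> (h p) (h q))"
      by (rule complex_Re_le_cmod)
    also have "\<dots> \<le> (\<Sum>p\<in>Q. \<Sum>q\<in>Q. C * C * norm (L2_inner \<mu> (h p) (h q)))"
    proof (intro sum_norm_le)
      fix p q assume "p \<in> Q" "q \<in> Q"
      then have "norm (c p) * norm (c q) \<le> C * C"
        using c by (intro mult_mono) (auto intro: order_trans[OF norm_ge_zero])
      then show "norm (c p * cnj (c q) * L2_inner \<mu> (h p) (h q))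
        \<le> C * C * norm (L2_inner \<mu> (h p) (h q))"
        by (simp add: norm_mult mult_right_mono)
    qed
    finally show ?thesis unfolding N_eq by (rule real_sqrt_le_mono)
  qed
  have N_lim: "(\<lambda>n. N (c n)) \<longlonglongrightarrow> 0" if "\<And>q. q \<in> Q \<Longrightarrow> (\<lambda>n. c n q) \<longlonglongrightarrow> 0" for c
  proof -
    have "(\<lambda>n. N (c n)) \<longlonglongrightarrow> sqrt (Re (\<Sum>p\<in>Q. \<Sum>q\<in>Q. 0 * cnj 0 * L2_inner \<mu> (h p) (h q)))"
      unfolding N_eq by (intro tendsto_intros that)
    then show ?thesis by simp
  qed
  have am: "a q \<in> borel_measurable \<mu>" if "q \<in> Q" for q
    using borel_measurable_continuous_map[OF a[OF that]] .
  \<comment> \<open>The approximants are dominated by twice the limit; this factor is the source of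
    the bounds \<open>2 * C\<close> and \<open>3 * C\<close>.\<close>
  have "\<exists>S. (\<forall>n. simple_function \<mu> (S n)) \<and> (\<forall>x\<in>space \<mu>. (\<lambda>n. S n x) \<longlonglongrightarrow> a q x) \<and>
      (\<forall>n. \<forall>x\<in>space \<mu>. dist (S n x) 0 \<le> 2 * dist (a q x) 0)" if "q \<in> Q" for q
    using borel_measurable_implies_sequence_metric[OF am[OF that]] .
  then obtain S where S: "\<And>q n. q \<in> Q \<Longrightarrow> simple_function \<mu> (S q n)"
      "\<And>q x. q \<in> Q \<Longrightarrow> x \<in> space \<mu> \<Longrightarrow> (\<lambda>n. S q n x) \<longlonglongrightarrow> a q x"
      "\<And>q n x. q \<in> Q \<Longrightarrow> x \<in> space \<mu> \<Longrightarrow> norm (S q n x) \<le> 2 * norm (a q x)"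
    unfolding dist_norm diff_0_right by metis
  have Sm: "S q n \<in> borel_measurable \<mu>" if "q \<in> Q" for q n
    using borel_measurable_simple_function[OF S(1)[OF that]] .
  have "\<exists>B. \<forall>x\<in>carrier G. norm (a q x) \<le> B" if "q \<in> Q" for q
    using continuous_map_bounded[OF a[OF that]] by metis
  then obtain B where B: "\<And>q x. q \<in> Q \<Longrightarrow> x \<in> carrier G \<Longrightarrow> norm (a q x) \<le> B q" by metis
  \<comment> \<open>One bound for all coefficients at once; the absolute values make each summand at
    most the sum.\<close>
  define C where "C = (\<Sum>q\<in>Q. \<bar>B q\<bar>)"
  have C: "norm (a q x) \<le> C" if "q \<in> Q" "x \<in> space \<mu>" for q x
  proof -
    have "norm (a q x) \<le> \<bar>B q\<bar>" using B[OF that(1)] that(2) space_haar by force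
    also have "\<dots> \<le> C" unfolding C_def using Q that by (intro member_le_sum) auto
    finally show ?thesis .
  qed
  have d: "norm (a q x - S q n x) \<le> 3 * C" if "q \<in> Q" "x \<in> space \<mu>" for q n x
    using norm_triangle_ineq4[of "a q x" "S q n x"] S(3)[OF that, of n] C[OF that] by linarith
  define s where "s n = (\<lambda>x y. \<Sum>q\<in>Q. S q n x * h q y)" for n
  have s_simple: "simple_function \<mu> (s n)" for n
    unfolding s_def using Q S(1) by (rule simple_function_lincomb)
  have Fs: "L2_norm \<mu> (\<lambda>y. F x y - s n x y) = N (\<lambda>q. a q x - S q n x)" if "x \<in> space \<mu>" for x n
    unfolding N_def s_def using that F space_haar
    by (intro L2_norm_cong) (simp add: sum_subtractf left_diff_distrib)
  have Nm: "(\<lambda>x. N (\<lambda>q. a q x - S q n x)) \<in> borel_measurable \<mu>" for n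
    unfolding N_eq
    by (intro measurable_compose[OF _ borel_measurable_sqrt]
        measurable_compose[OF _ borel_measurable_Re] borel_measurable_sum borel_measurable_times
        borel_measurable_cnj borel_measurable_diff borel_measurable_const am Sm)
  let ?b = "sqrt (\<Sum>p\<in>Q. \<Sum>q\<in>Q. (3 * C) * (3 * C) * norm (L2_inner \<mu> (h p) (h q)))"
  have N0: "0 \<le> N c" for c unfolding N_def L2_norm_def by simp
  have Nb: "norm (N (\<lambda>q. a q x - S q n x)) \<le> ?b" if "x \<in> space \<mu>" for x n
    using N_le[of "\<lambda>q. a q x - S q n x" "3 * C"] d[OF _ that] N0 by simp
  have Nint: "integrable \<mu> (\<lambda>x. N (\<lambda>q. a q x - S q n x))" for n
    using Nm Nb by (intro integrable_const_bound[of _ ?b] AE_I2) auto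
  have int: "integrable \<mu> (\<lambda>x. L2_norm \<mu> (\<lambda>y. F x y - s n x y))" for n
    using Nint by (subst Bochner_Integration.integrable_cong[OF refl Fs])
  have "(\<lambda>n. LINT x|\<mu>. N (\<lambda>q. a q x - S q n x)) \<longlonglongrightarrow> (LINT x|\<mu>. 0)"
  proof (rule integral_dominated_convergence[where w = "\<lambda>_. ?b"])
    show "AE x in \<mu>. (\<lambda>n. N (\<lambda>q. a q x - S q n x)) \<longlonglongrightarrow> 0"
    proof (intro AE_I2 N_lim)
      fix x q assume "x \<in> space \<mu>" "q \<in> Q"
      then have "(\<lambda>n. a q x - S q n x) \<longlonglongrightarrow> a q x - a q x" by (intro tendsto_intros S(2))
      then show "(\<lambda>n. a q x - S q n x) \<longlonglongrightarrow> 0" by simp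
    qed
  qed (use Nm Nb in auto)
  then have lim1: "(\<lambda>n. LINT x|\<mu>. L2_norm \<mu> (\<lambda>y. F x y - s n x y)) \<longlonglongrightarrow> 0"
    by (subst Bochner_Integration.integral_cong[OF refl Fs]) auto
  have Sint: "integrable \<mu> (S q n)" if "q \<in> Q" for q n
    using Sm[OF that] S(3)[OF that, of _ n] C[OF that]
    by (intro integrable_const_bound[of _ "2 * C"] AE_I2) force+
  \<comment> \<open>Evaluation at \<open>y\<close>, taken as \<phi>, turns the integral of the
    function-valued \<open>s n\<close> into an ordinary integral of a finite sum.\<close>
  have simp_eq: "simple_L2_integral \<mu> (s n) y = (\<Sum>q\<in>Q. (LINT x|\<mu>. S q n x) * h q y)" for n y
  proof -
    have "simple_L2_integral \<mu> (s n) y = (LINT x|\<mu>. s n x y)"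
      unfolding simple_L2_integral_def
      using simple_function_image_integral(2)[OF s_simple, where \<phi> = "\<lambda>f. f y"] by simp
    also have "\<dots> = (\<Sum>q\<in>Q. (LINT x|\<mu>. S q n x) * h q y)"
      unfolding s_def using Sint by (subst Bochner_Integration.integral_sum) auto
    finally show ?thesis .
  qed
  have "(\<lambda>n. LINT x|\<mu>. S q n x) \<longlonglongrightarrow> (LINT x|\<mu>. a q x)" if "q \<in> Q" for q
  proof (rule integral_dominated_convergence[where w = "\<lambda>_. 2 * C"])
    show "AE x in \<mu>. norm (S q n x) \<le> 2 * C" for n
      using S(3)[OF that, of _ n] C[OF that] by (intro AE_I2) force
  qed (use am Sm that S(2) in auto)
  then have "(\<lambda>n. (LINT x|\<mu>. a q x) - (LINT x|\<mu>. S q n x)) \<longlonglongrightarrow> 0" if "q \<in> Q" for q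
    using tendsto_diff[OF tendsto_const[of "LINT x|\<mu>. a q x"]] that by fastforce
  then have "(\<lambda>n. N (\<lambda>q. (LINT x|\<mu>. a q x) - (LINT x|\<mu>. S q n x))) \<longlonglongrightarrow> 0"
    by (rule N_lim)
  then have lim2: "(\<lambda>n. L2_norm \<mu> (\<lambda>y. (\<Sum>q\<in>Q. (LINT x|\<mu>. a q x) * h q y)
      - simple_L2_integral \<mu> (s n) y)) \<longlonglongrightarrow> 0"
    unfolding simp_eq N_def by (simp add: sum_subtractf left_diff_distrib)
  have "F x \<in> L2 \<mu>" if "x \<in> space \<mu>" for x
    using that F space_haar hL2[of "\<lambda>q. a q x"]
    by (subst L2_cong[of _ _ "\<lambda>y. \<Sum>q\<in>Q. a q x * h q y"]) auto
  moreover have "s n x \<in> L2 \<mu>" for n x unfolding s_def by (rule hL2)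
  ultimately show ?thesis
    unfolding has_L2_integral_def
    by (intro conjI ballI allI exI[of _ s] hL2 s_simple int lim1 lim2)
qed

end

section \<open>Conjugation and coupling coefficients\<close>

lemma mat_inner_sum:
  assumes "A \<in> carrier_mat n n" "B \<in> carrier_mat n n"
  shows "mat_inner A B = (\<Sum>r<n. \<Sum>s<n. A $$ (r, s) * cnj (B $$ (r, s)))"
proof -
  have "mat_inner A B = (\<Sum>r<n. (A * mat_adjoint B) $$ (r, r))"
    using assms by (simp add: mat_inner_def mat_trace_def)
  also have "\<dots> = (\<Sum>r<n. \<Sum>s<n. A $$ (r, s) * cnj (B $$ (r, s)))"
    using assms by (intro sum.cong refl)
      (simp add: index_mat_mult_sum[OF assms(1) mat_adjoint_carrier[OF assms(2)]]
        del: index_mult_mat(1))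
  finally show ?thesis .
qed

lemma mat_inner_cnj:
  assumes "A \<in> carrier_mat n n" "B \<in> carrier_mat n n"
  shows "mat_inner B A = cnj (mat_inner A B)"
  using assms by (simp add: mat_inner_sum cnj_sum mult.commute)

lemma mat_lincomb_carrier [simp]: "mat_lincomb n I a f \<in> carrier_mat n n"
  by (simp add: mat_lincomb_def)

lemma mat_lincomb_index [simp]:
  "r < n \<Longrightarrow> s < n \<Longrightarrow> mat_lincomb n I a f $$ (r, s) = (\<Sum>x\<in>I. a x * f x $$ (r, s))"
  by (simp add: mat_lincomb_def)

lemma mat_inner_lincomb_left:
  assumes "B \<in> carrier_mat n n" "\<And>x. x \<in> I \<Longrightarrow> f x \<in> carrier_mat n n"
  shows "mat_inner (mat_lincomb n I a f) B = (\<Sum>x\<in>I. a x * mat_inner (f x) B)"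
proof -
  have "mat_inner (mat_lincomb n I a f) B
    = (\<Sum>r<n. \<Sum>s<n. \<Sum>x\<in>I. a x * (f x $$ (r, s) * cnj (B $$ (r, s))))"
    using assms(1) by (simp add: mat_inner_sum[of _ n] sum_distrib_right mult.assoc)
  also have "\<dots> = (\<Sum>r<n. \<Sum>x\<in>I. \<Sum>s<n. a x * (f x $$ (r, s) * cnj (B $$ (r, s))))"
    by (intro sum.cong refl sum.swap)
  also have "\<dots> = (\<Sum>x\<in>I. \<Sum>r<n. \<Sum>s<n. a x * (f x $$ (r, s) * cnj (B $$ (r, s))))"
    by (rule sum.swap)
  also have "\<dots> = (\<Sum>x\<in>I. a x * mat_inner (f x) B)"
    using assms by (intro sum.cong refl) (simp add: mat_inner_sum[of _ n] sum_distrib_left)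
  finally show ?thesis .
qed

text \<open>The combination stands in the antilinear slot, hence the conjugate; it is the one that
  the final formula carries on a coupling coefficient.\<close>

lemma mat_inner_basis_lincomb:
  assumes f: "orthonormal_mat_basis n I f" and x: "x \<in> I"
  shows "mat_inner (f x) (mat_lincomb n I a f) = cnj (a x)"
proof -
  have c: "f y \<in> carrier_mat n n" if "y \<in> I" for y
    using f that unfolding orthonormal_mat_basis_def by auto
  have fin: "finite I" using f unfolding orthonormal_mat_basis_def by auto
  have "mat_inner (mat_lincomb n I a f) (f x) = (\<Sum>y\<in>I. a y * mat_inner (f y) (f x))"
    using c x by (intro mat_inner_lincomb_left) auto
  also have "\<dots> = (\<Sum>y\<in>I. if y = x then a x else 0)"
    using f x unfolding orthonormal_mat_basis_def by (intro sum.cong) auto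
  also have "\<dots> = a x" using fin x by simp
  finally show ?thesis using mat_inner_cnj[of "mat_lincomb n I a f" n "f x"] c[OF x] by simp
qed

text \<open>The adjoint of the rank-one operator \<open>E_ij\<close> is \<open>E_ji\<close>, so the
  trace collapses to one coefficient of \<open>A\<close>. This puts matrix elements in a form where
  both the operator and the unit can be expanded in the coupling basis.\<close>

lemma mat_inner_matrix_unit:
  assumes "A \<in> carrier_mat n n" "v i \<in> carrier_vec n" "v j \<in> carrier_vec n"
  shows "mat_inner A (matrix_unit n v i j) = (A *\<^sub>v v j) \<bullet>c v i"
proof -
  have "matrix_unit n v i j \<in> carrier_mat n n" by (simp add: matrix_unit_def)
  then show ?thesis
    using assms by (subst mat_coeff_sum[of _ n])
      (auto simp: mat_inner_sum[of _ n] matrix_unit_def sum.cartesian_product[symmetric] mult_ac)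
qed

text \<open>With \<open>A = T x\<close> and \<open>B = T (inv x)\<close> this moves the conjugation
  action inside an expansion.\<close>

lemma mat_lincomb_sandwich:
  assumes A: "A \<in> carrier_mat n n" and B: "B \<in> carrier_mat n n"
    and f: "\<And>x. x \<in> I \<Longrightarrow> f x \<in> carrier_mat n n"
  shows "A * mat_lincomb n I a f * B = mat_lincomb n I a (\<lambda>x. A * f x * B)"
proof (rule eq_matI)
  have expand: "(A * M * B) $$ (r, s) = (\<Sum>t<n. \<Sum>q<n. A $$ (r, q) * M $$ (q, t) * B $$ (t, s))"
    if "M \<in> carrier_mat n n" "r < n" "s < n" for M r s
    using index_mat_mult_sum[OF mult_carrier_mat[OF A that(1)] B that(2,3)]
      index_mat_mult_sum[OF A that(1) that(2)] by (simp add: sum_distrib_right del: index_mult_mat(1))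
  fix r s assume "r < dim_row (mat_lincomb n I a (\<lambda>x. A * f x * B))"
    "s < dim_col (mat_lincomb n I a (\<lambda>x. A * f x * B))"
  then have rs: "r < n" "s < n" by (auto simp: mat_lincomb_def)
  have "(A * mat_lincomb n I a f * B) $$ (r, s)
    = (\<Sum>t<n. \<Sum>q<n. \<Sum>x\<in>I. a x * (A $$ (r, q) * f x $$ (q, t) * B $$ (t, s)))"
    unfolding expand[OF mat_lincomb_carrier rs]
    by (simp add: sum_distrib_left sum_distrib_right mult_ac)
  also have "\<dots> = (\<Sum>t<n. \<Sum>x\<in>I. \<Sum>q<n. a x * (A $$ (r, q) * f x $$ (q, t) * B $$ (t, s)))"
    by (intro sum.cong refl sum.swap)
  also have "\<dots> = (\<Sum>x\<in>I. \<Sum>t<n. \<Sum>q<n. a x * (A $$ (r, q) * f x $$ (q, t) * B $$ (t, s)))"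
    by (rule sum.swap)
  also have "\<dots> = (\<Sum>x\<in>I. a x * (A * f x * B) $$ (r, s))"
    using f rs by (intro sum.cong refl) (simp add: expand sum_distrib_left del: index_mult_mat(1))
  finally show "(A * mat_lincomb n I a f * B) $$ (r, s)
    = mat_lincomb n I a (\<lambda>x. A * f x * B) $$ (r, s)"
    using rs by simp
qed (use A B in \<open>auto simp: mat_lincomb_def\<close>)

text \<open>Expand \<open>T \<sigma> g\<^sub>0\<close> in the basis \<open>e\<close>, let \<open>x\<close> act by conjugation and read off the \<open>(u, i)\<close> entry
  as the inner product with \<open>E\<^sub>u\<^sub>i\<close>.\<close>

lemma mat_elem_conjugate_coupling:
  fixes G (structure)
  assumes "group G"
    and R: "unitary_rep G X (T \<sigma>)" and b: "orthonormal_vec_basis (rep_dim G (T \<sigma>)) (b \<sigma>)"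
    and e: "coupling_basis G X T b \<sigma> e" and c: "coupling_coeffs G X T b \<sigma> e c"
    and g0: "g\<^sub>0 \<in> carrier G" and x: "x \<in> carrier G"
    and u: "u < rep_dim G (T \<sigma>)" and i: "i < rep_dim G (T \<sigma>)"
  shows "mat_elem (T \<sigma>) (b \<sigma>) u i (x \<otimes> g\<^sub>0 \<otimes> inv x)
    = (\<Sum>(\<beta>, m, q)\<in>coupling_index G X T \<sigma>.
        (\<Sum>p<rep_dim G (T \<sigma>). \<Sum>r<rep_dim G (T \<sigma>). c p r \<beta> m q * mat_elem (T \<sigma>) (b \<sigma>) p r g\<^sub>0) *
        (\<Sum>p<rep_dim G (T \<beta>). mat_elem (T \<beta>) (b \<beta>) p q x * cnj (c u i \<beta> m p)))"
proof -
  interpret group G by fact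
  define n where "n = rep_dim G (T \<sigma>)"
  define I where "I = coupling_index G X T \<sigma>"
  define E where "E = (\<lambda>(\<beta>, m, q). e \<beta> m q)"
  define t where "t = mat_elem (T \<sigma>) (b \<sigma>)"
  \<comment> \<open>Coefficients of \<open>T \<sigma> g\<^sub>0\<close> in the basis
    \<open>e\<close>: the operator is the sum of \<open>t p r g\<^sub>0\<close> times matrix units,
    and each unit contributes its coupling coefficients.\<close>
  define d where "d = (\<lambda>(\<beta>, m, q). \<Sum>p<n. \<Sum>r<n. c p r \<beta> m q * t p r g\<^sub>0)"
  note b = b[folded n_def] and u = u[folded n_def] and i = i[folded n_def]
  note bc = orthonormal_vec_basis_carrier[OF b]
  note cR = unitary_repD(1)[OF R, folded n_def]
  have E: "orthonormal_mat_basis n I E"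
    using e unfolding coupling_basis_def n_def I_def E_def by auto
  then have Ec: "E y \<in> carrier_mat n n" if "y \<in> I" for y
    using that unfolding orthonormal_mat_basis_def by auto
  have act: "conj_act G (T \<sigma>) x (E (\<beta>, m, q)) = mat_lincomb n {..<rep_dim G (T \<beta>)}
      (\<lambda>p. mat_elem (T \<beta>) (b \<beta>) p q x) (\<lambda>p. E (\<beta>, m, p))" if "(\<beta>, m, q) \<in> I" for \<beta> m q
    using e x that unfolding coupling_basis_def n_def I_def E_def by auto
  have mu: "matrix_unit n (b \<sigma>) p r = mat_lincomb n I (\<lambda>(\<beta>, m, q). c p r \<beta> m q) E"
    if "p < n" "r < n" for p r
    using c that unfolding coupling_coeffs_def n_def I_def E_def by auto
  have Tg0: "T \<sigma> g\<^sub>0 = mat_lincomb n I d E"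
  proof (rule eq_matI)
    fix r s assume "r < dim_row (mat_lincomb n I d E)" "s < dim_col (mat_lincomb n I d E)"
    then have rs: "r < n" "s < n" by (auto simp: mat_lincomb_def)
    have "T \<sigma> g\<^sub>0 $$ (r, s)
      = (\<Sum>p<n. \<Sum>q<n. \<Sum>y\<in>I. (case y of (\<beta>, m, l) \<Rightarrow> c p q \<beta> m l) * t p q g\<^sub>0 * E y $$ (r, s))"
      unfolding mat_expand_basis[OF b cR[OF g0] rs] using rs mu
      by (intro sum.cong refl) (simp add: t_def mat_elem_def sum_distrib_left mult_ac)
    also have "\<dots> = (\<Sum>p<n. \<Sum>y\<in>I. \<Sum>q<n. (case y of (\<beta>, m, l) \<Rightarrow> c p q \<beta> m l) * t p q g\<^sub>0 * E y $$ (r, s))"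
      by (intro sum.cong refl sum.swap)
    also have "\<dots> = (\<Sum>y\<in>I. \<Sum>p<n. \<Sum>q<n. (case y of (\<beta>, m, l) \<Rightarrow> c p q \<beta> m l) * t p q g\<^sub>0 * E y $$ (r, s))"
      by (rule sum.swap)
    also have "\<dots> = mat_lincomb n I d E $$ (r, s)"
      using rs by (auto simp: d_def sum_distrib_right intro!: sum.cong)
    finally show "T \<sigma> g\<^sub>0 $$ (r, s) = mat_lincomb n I d E $$ (r, s)" .
  qed (use cR[OF g0] in \<open>auto simp: mat_lincomb_def\<close>)
  have xi: "x \<otimes> g\<^sub>0 \<in> carrier G" "inv x \<in> carrier G" using x g0 by auto
  have conj_c: "conj_act G (T \<sigma>) x (E y) \<in> carrier_mat n n" if "y \<in> I" for y
    using cR[OF x] cR[OF xi(2)] Ec[OF that] unfolding conj_act_def by auto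
  have "T \<sigma> (x \<otimes> g\<^sub>0 \<otimes> inv x) = conj_act G (T \<sigma>) x (T \<sigma> g\<^sub>0)"
    using unitary_repD(4)[OF R xi] unitary_repD(4)[OF R x g0] by (simp add: conj_act_def)
  also have "\<dots> = mat_lincomb n I d (\<lambda>y. conj_act G (T \<sigma>) x (E y))"
    unfolding Tg0 conj_act_def using cR[OF x] cR[OF xi(2)] Ec by (rule mat_lincomb_sandwich)
  finally have Tx: "T \<sigma> (x \<otimes> g\<^sub>0 \<otimes> inv x) = mat_lincomb n I d (\<lambda>y. conj_act G (T \<sigma>) x (E y))" .
  have "t u i (x \<otimes> g\<^sub>0 \<otimes> inv x) = mat_inner (T \<sigma> (x \<otimes> g\<^sub>0 \<otimes> inv x)) (matrix_unit n (b \<sigma>) u i)"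
    unfolding t_def mat_elem_def using cR xi bc u i by (subst mat_inner_matrix_unit) auto
  also have "\<dots> = (\<Sum>y\<in>I. d y * mat_inner (conj_act G (T \<sigma>) x (E y)) (matrix_unit n (b \<sigma>) u i))"
    unfolding Tx using conj_c by (intro mat_inner_lincomb_left) (auto simp: matrix_unit_def)
  also have "\<dots> = (\<Sum>(\<beta>, m, q)\<in>I. d (\<beta>, m, q) *
      (\<Sum>p<rep_dim G (T \<beta>). mat_elem (T \<beta>) (b \<beta>) p q x * cnj (c u i \<beta> m p)))"
  proof (intro sum.cong refl, clarify)
    fix \<beta> m q assume y: "(\<beta>, m, q) \<in> I"
    \<comment> \<open>For given (\<beta>, m) the index set contains every admissible last index, so
      the expansion of the conjugated basis element stays within the basis.\<close>
    then have p: "(\<beta>, m, p) \<in> I" if "p < rep_dim G (T \<beta>)" for p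
      using that unfolding I_def coupling_index_def by auto
    have "mat_inner (conj_act G (T \<sigma>) x (E (\<beta>, m, q))) (matrix_unit n (b \<sigma>) u i)
      = (\<Sum>p<rep_dim G (T \<beta>). mat_elem (T \<beta>) (b \<beta>) p q x *
          mat_inner (E (\<beta>, m, p)) (matrix_unit n (b \<sigma>) u i))"
      unfolding act[OF y] using p Ec by (intro mat_inner_lincomb_left) (auto simp: matrix_unit_def)
    also have "\<dots> = (\<Sum>p<rep_dim G (T \<beta>). mat_elem (T \<beta>) (b \<beta>) p q x * cnj (c u i \<beta> m p))"
      unfolding mu[OF u i] using p mat_inner_basis_lincomb[OF E] by (intro sum.cong) auto
    finally show "d (\<beta>, m, q) * mat_inner (conj_act G (T \<sigma>) x (E (\<beta>, m, q))) (matrix_unit n (b \<sigma>) u i)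
      = d (\<beta>, m, q) * (\<Sum>p<rep_dim G (T \<beta>). mat_elem (T \<beta>) (b \<beta>) p q x * cnj (c u i \<beta> m p))"
      by simp
  qed
  finally show ?thesis unfolding t_def n_def I_def d_def by simp
qed

section \<open>Conjugated matrix elements against matrix elements of \<alpha>\<close>

context compact_group_haar
begin

lemma continuous_map_conjugate:
  assumes "g \<in> carrier G"
  shows "continuous_map X X (\<lambda>x. x \<otimes> g \<otimes> inv x)"
proof -
  have mult: "continuous_map X X (\<lambda>x. f x \<otimes> h x)"
    if "continuous_map X X f" "continuous_map X X h" for f h
  proof -
    have "continuous_map X X ((\<lambda>(x, y). x \<otimes> y) \<circ> (\<lambda>x. (f x, h x)))"
      using that by (intro continuous_map_compose[OF _ continuous_mult] continuous_map_pairedI)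
    then show ?thesis by (simp add: comp_def)
  qed
  show ?thesis
    using assms topspace_eq continuous_inv by (intro mult) auto
qed

lemma mat_elem_conjugate_continuous:
  assumes "unitary_rep G X R" "orthonormal_vec_basis (rep_dim G R) v"
    "i < rep_dim G R" "j < rep_dim G R" "g \<in> carrier G"
  shows "continuous_map X euclidean (\<lambda>x. mat_elem R v i j (x \<otimes> g \<otimes> inv x))"
  using continuous_map_compose[OF continuous_map_conjugate[OF assms(5)] mat_elem_continuous[OF assms(1-4)]]
  by (simp add: comp_def)

text \<open>The expansion is flattened to a single sum over ((\<beta>, m, q), p), whose functions
  are the matrix elements \<open>p q\<close> of \<beta>. Orthogonality to the element
  \<open>k l\<close> of \<alpha> forces \<beta> = \<alpha>, p = k and q = l and leaves only m free,
  which is the sum over multiplicities.\<close>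

lemma L2_inner_mat_elem_conjugate:
  assumes T: "\<And>\<rho>. \<rho> \<in> unitary_dual G X \<Longrightarrow> T \<rho> \<in> \<rho>"
    and b: "\<And>\<rho>. \<rho> \<in> unitary_dual G X \<Longrightarrow> orthonormal_vec_basis (rep_dim G (T \<rho>)) (b \<rho>)"
    and e: "coupling_basis G X T b \<sigma> e" and c: "coupling_coeffs G X T b \<sigma> e c"
    and \<sigma>: "\<sigma> \<in> unitary_dual G X" and \<alpha>: "\<alpha> \<in> unitary_dual G X"
    and g0: "g\<^sub>0 \<in> carrier G" and u: "u < rep_dim G (T \<sigma>)" and i: "i < rep_dim G (T \<sigma>)"
    and k: "k < rep_dim G (T \<alpha>)" and l: "l < rep_dim G (T \<alpha>)"
  shows "L2_inner \<mu> (\<lambda>x. mat_elem (T \<sigma>) (b \<sigma>) u i (x \<otimes> g\<^sub>0 \<otimes> inv x)) (mat_elem (T \<alpha>) (b \<alpha>) k l)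
    = 1 / of_nat (rep_dim G (T \<alpha>)) * (\<Sum>m<conj_multiplicity G X (T \<sigma>) \<alpha>. cnj (c u i \<alpha> m k) *
        (\<Sum>p<rep_dim G (T \<sigma>). \<Sum>r<rep_dim G (T \<sigma>). c p r \<alpha> m l * mat_elem (T \<sigma>) (b \<sigma>) p r g\<^sub>0))"
proof -
  have uni: "unitary_rep G X (T \<rho>)" if "\<rho> \<in> unitary_dual G X" for \<rho>
    using unitary_dual_irreducible[OF that T[OF that]] by (rule irreducible_rep_unitary)
  define I where "I = coupling_index G X T \<sigma>"
  define d where "d \<beta> m q = (\<Sum>p<rep_dim G (T \<sigma>). \<Sum>r<rep_dim G (T \<sigma>).
    c p r \<beta> m q * mat_elem (T \<sigma>) (b \<sigma>) p r g\<^sub>0)" for \<beta> m q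
  define J where "J = Sigma I (\<lambda>(\<beta>, m, q). {..<rep_dim G (T \<beta>)})"
  define w where "w = (\<lambda>((\<beta>, m, q), p). d \<beta> m q * cnj (c u i \<beta> m p))"
  define f where "f = (\<lambda>((\<beta>, m :: nat, q), p). mat_elem (T \<beta>) (b \<beta>) p q)"
  have fin: "finite I"
    using e unfolding coupling_basis_def orthonormal_mat_basis_def I_def by auto
  have cont: "continuous_map X euclidean (f z)" if "z \<in> J" for z
    using that uni b
    by (auto simp: f_def J_def I_def coupling_index_def intro!: mat_elem_continuous)
  have expand: "mat_elem (T \<sigma>) (b \<sigma>) u i (x \<otimes> g\<^sub>0 \<otimes> inv x) = (\<Sum>z\<in>J. w z * f z x)"
    if "x \<in> carrier G" for x
  proof -
    have "mat_elem (T \<sigma>) (b \<sigma>) u i (x \<otimes> g\<^sub>0 \<otimes> inv x) = (\<Sum>y\<in>I. \<Sum>p\<in>(case y of (\<beta>, m, q) \<Rightarrow> {..<rep_dim G (T \<beta>)}).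
        w (y, p) * f (y, p) x)"
      unfolding mat_elem_conjugate_coupling[OF is_group uni[OF \<sigma>] b[OF \<sigma>] e c g0 that u i]
        I_def d_def[symmetric]
      by (intro sum.cong refl) (auto simp: w_def f_def sum_distrib_left mult_ac)
    also have "\<dots> = (\<Sum>z\<in>J. w z * f z x)"
      unfolding J_def using fin by (subst sum.Sigma) auto
    finally show ?thesis .
  qed
  have "L2_inner \<mu> (\<lambda>x. mat_elem (T \<sigma>) (b \<sigma>) u i (x \<otimes> g\<^sub>0 \<otimes> inv x)) (mat_elem (T \<alpha>) (b \<alpha>) k l)
    = L2_inner \<mu> (\<lambda>x. \<Sum>z\<in>J. w z * f z x) (\<lambda>x. \<Sum>y\<in>{()}. 1 * mat_elem (T \<alpha>) (b \<alpha>) k l x)"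
    using expand space_haar by (intro L2_inner_cong) auto
  also have "\<dots> = (\<Sum>z\<in>J. w z * L2_inner \<mu> (f z) (mat_elem (T \<alpha>) (b \<alpha>) k l))"
    using cont mat_elem_continuous[OF uni[OF \<alpha>] b[OF \<alpha>] k l] by (subst L2_inner_lincomb) auto
  \<comment> \<open>The surviving indices. If \<alpha> has multiplicity 0 the set is empty and the
    pairing vanishes.\<close>
  also have "\<dots> = (\<Sum>z\<in>(\<lambda>m. ((\<alpha>, m, l), k)) ` {..<conj_multiplicity G X (T \<sigma>) \<alpha>}.
      w z * L2_inner \<mu> (f z) (mat_elem (T \<alpha>) (b \<alpha>) k l))"
  proof (rule sum.mono_neutral_right)
    show "finite J" unfolding J_def using fin by auto
    show "(\<lambda>m. ((\<alpha>, m, l), k)) ` {..<conj_multiplicity G X (T \<sigma>) \<alpha>} \<subseteq> J"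
      using \<alpha> k l by (auto simp: J_def I_def coupling_index_def)
    show "\<forall>z\<in>J - (\<lambda>m. ((\<alpha>, m, l), k)) ` {..<conj_multiplicity G X (T \<sigma>) \<alpha>}.
      w z * L2_inner \<mu> (f z) (mat_elem (T \<alpha>) (b \<alpha>) k l) = 0"
      using unitary_dual_orthogonality[OF T b _ \<alpha> _ _ k l]
      by (auto simp: J_def I_def f_def coupling_index_def split: if_splits)
  qed
  also have "\<dots> = (\<Sum>m<conj_multiplicity G X (T \<sigma>) \<alpha>.
      d \<alpha> m l * cnj (c u i \<alpha> m k) * (1 / of_nat (rep_dim G (T \<alpha>))))"
    using unitary_dual_orthogonality[OF T b \<alpha> \<alpha> k l k l]
    by (subst sum.reindex) (auto simp: inj_on_def w_def f_def)
  finally show ?thesis unfolding d_def[symmetric] by (simp add: sum_distrib_left mult_ac)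
qed

end

section \<open>The weighted class operator\<close>

context compact_group_haar
begin

text \<open>Translates of the conjugated matrix element stay in the span of the conjugates of column
  j, with scalar coefficients depending on \<open>x\<close>. Pairing with \<open>h\<close> therefore
  only requires the integrals of these coefficients.\<close>

lemma weighted_class_op_inner:
  assumes R: "unitary_rep G X R" and v: "orthonormal_vec_basis (rep_dim G R) v"
    and \<phi>: "continuous_map X euclidean \<phi>" and h: "continuous_map X euclidean h"
    and g: "g \<in> carrier G" and ij: "i < rep_dim G R" "j < rep_dim G R"
  shows "L2_inner \<mu> (weighted_class_op G \<mu> \<phi> g (\<lambda>x. cnj (mat_elem R v i j x))) h
    = (\<Sum>q<rep_dim G R. (LINT x|\<mu>. \<phi> x * mat_elem R v q i (x \<otimes> g \<otimes> inv x)) *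
        L2_inner \<mu> (\<lambda>y. cnj (mat_elem R v q j y)) h)"
proof -
  define Q where "Q = {..<rep_dim G R}"
  define t where "t = mat_elem R v"
  define F where "F = (\<lambda>x y. \<phi> x * left_reg G (x \<otimes> g \<otimes> inv x) (\<lambda>x. cnj (t i j x)) y)"
  define a where "a q x = \<phi> x * t q i (x \<otimes> g \<otimes> inv x)" for q x
  have a: "continuous_map X euclidean (a q)" if "q \<in> Q" for q
    unfolding a_def t_def using that mat_elem_conjugate_continuous[OF R v _ _ g] \<phi> ij
    by (intro continuous_intros) (auto simp: Q_def)
  have t: "continuous_map X euclidean (\<lambda>y. cnj (t q j y))" if "q \<in> Q" for q
    unfolding t_def using that mat_elem_continuous[OF R v] ij
    by (intro continuous_intros) (auto simp: Q_def)
  have F: "F x y = (\<Sum>q\<in>Q. a q x * cnj (t q j y))" if x: "x \<in> carrier G" and y: "y \<in> carrier G" for x y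
  proof -
    let ?w = "x \<otimes> g \<otimes> inv x"
    have w: "?w \<in> carrier G" using x g by auto
    \<comment> \<open>Multiplicativity at \<open>inv ?w\<close> and \<open>y\<close>, then
      unitarity: the conjugate of \<open>t i q (inv ?w)\<close> is \<open>t q i ?w\<close>.\<close>
    have "cnj (t i j (inv ?w \<otimes> y)) = (\<Sum>q\<in>Q. t q i ?w * cnj (t q j y))"
      unfolding t_def mat_elem_mult[OF R v inv_closed[OF w] y ij] Q_def
      using mat_elem_inv[OF is_group R v w] ij by (simp add: cnj_sum)
    then show ?thesis
      by (simp add: F_def left_reg_def a_def sum_distrib_left mult.assoc)
  qed
  have "finite Q" by (simp add: Q_def)
  then have "has_L2_integral \<mu> F (\<lambda>y. \<Sum>q\<in>Q. (LINT x|\<mu>. a q x) * cnj (t q j y))"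
    using t a F by (rule has_L2_integral_finite_rank)
  \<comment> \<open>An integral has been exhibited, so the function chosen by
    \<open>strong_integral\<close> is an integral as well, though perhaps a different
    representative.\<close>
  then have W: "has_L2_integral \<mu> F (weighted_class_op G \<mu> \<phi> g (\<lambda>x. cnj (t i j x)))"
    unfolding weighted_class_op_def strong_integral_def F_def[symmetric] by (rule someI[of "has_L2_integral \<mu> F"])
  obtain B where B: "\<And>x. x \<in> carrier G \<Longrightarrow> norm (h x) \<le> B"
    using continuous_map_bounded[OF h] by blast
  have Fh: "L2_inner \<mu> (F x) h = (\<Sum>q\<in>Q. a q x * L2_inner \<mu> (\<lambda>y. cnj (t q j y)) h)"
    if "x \<in> space \<mu>" for x
  proof -
    have "L2_inner \<mu> (F x) h
      = L2_inner \<mu> (\<lambda>y. \<Sum>q\<in>Q. a q x * cnj (t q j y)) (\<lambda>y. \<Sum>z\<in>{()}. 1 * h y)"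
      using F that space_haar by (intro L2_inner_cong) auto
    also have "\<dots> = (\<Sum>q\<in>Q. a q x * L2_inner \<mu> (\<lambda>y. cnj (t q j y)) h)"
      using t h by (subst L2_inner_lincomb) auto
    finally show ?thesis .
  qed
  have aint: "integrable \<mu> (\<lambda>x. a q x * L2_inner \<mu> (\<lambda>y. cnj (t q j y)) h)" if "q \<in> Q" for q
    using integrable_continuous_map[OF a[OF that]] by simp
  have "integrable \<mu> (\<lambda>x. L2_inner \<mu> (F x) h)"
    using aint by (subst Bochner_Integration.integrable_cong[OF refl Fh]) auto
  then have "L2_inner \<mu> (weighted_class_op G \<mu> \<phi> g (\<lambda>x. cnj (t i j x))) h
    = (LINT x|\<mu>. L2_inner \<mu> (F x) h)"
    using B space_haar by (intro has_L2_integral_inner[OF W borel_measurable_continuous_map[OF h]]) auto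
  also have "\<dots> = (LINT x|\<mu>. (\<Sum>q\<in>Q. a q x * L2_inner \<mu> (\<lambda>y. cnj (t q j y)) h))"
    by (rule Bochner_Integration.integral_cong[OF refl Fh])
  also have "\<dots> = (\<Sum>q\<in>Q. (LINT x|\<mu>. a q x) * L2_inner \<mu> (\<lambda>y. cnj (t q j y)) h)"
    using aint by (subst Bochner_Integration.integral_sum) auto
  finally show ?thesis unfolding Q_def a_def t_def .
qed

end

theorem theorem2:
  fixes G :: "'g monoid" and X :: "'g topology" and \<mu> :: "'g measure"
    and g\<^sub>0 :: 'g
    and T :: "('g \<Rightarrow> complex mat) set \<Rightarrow> 'g \<Rightarrow> complex mat"
    and b :: "('g \<Rightarrow> complex mat) set \<Rightarrow> nat \<Rightarrow> complex vec"
    and e :: "('g \<Rightarrow> complex mat) set \<Rightarrow> ('g \<Rightarrow> complex mat) set \<Rightarrow> nat \<Rightarrow> nat \<Rightarrow> complex mat"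
    and c :: "('g \<Rightarrow> complex mat) set \<Rightarrow> nat \<Rightarrow> nat \<Rightarrow> ('g \<Rightarrow> complex mat) set \<Rightarrow> nat \<Rightarrow> nat \<Rightarrow> complex"
    and \<alpha> \<sigma> \<gamma> :: "('g \<Rightarrow> complex mat) set"
    and k l i j u v :: nat
  assumes "compact_group_haar G X \<mu>"
    and "g\<^sub>0 \<in> carrier G"
    and "\<And>\<rho>. \<rho> \<in> unitary_dual G X \<Longrightarrow> T \<rho> \<in> \<rho>"
    and "\<And>\<rho>. \<rho> \<in> unitary_dual G X \<Longrightarrow> orthonormal_vec_basis (rep_dim G (T \<rho>)) (b \<rho>)"
    and "\<And>\<rho>. \<rho> \<in> unitary_dual G X \<Longrightarrow> coupling_basis G X T b \<rho> (e \<rho>)"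
    and "\<And>\<rho>. \<rho> \<in> unitary_dual G X \<Longrightarrow> coupling_coeffs G X T b \<rho> (e \<rho>) (c \<rho>)"
    and "\<alpha> \<in> unitary_dual G X" and "\<sigma> \<in> unitary_dual G X" and "\<gamma> \<in> unitary_dual G X"
    and "k < rep_dim G (T \<alpha>)" and "l < rep_dim G (T \<alpha>)"
    and "i < rep_dim G (T \<sigma>)" and "j < rep_dim G (T \<sigma>)"
    and "u < rep_dim G (T \<gamma>)" and "v < rep_dim G (T \<gamma>)"
  shows "of_nat (rep_dim G (T \<sigma>)) *
      L2_inner \<mu>
        (weighted_class_op G \<mu> (\<lambda>x. cnj (mat_elem (T \<alpha>) (b \<alpha>) k l x)) g\<^sub>0
           (\<lambda>x. cnj (mat_elem (T \<sigma>) (b \<sigma>) i j x)))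
        (\<lambda>x. cnj (mat_elem (T \<gamma>) (b \<gamma>) u v x))
    = 1 / of_nat (rep_dim G (T \<alpha>)) *
      (if \<gamma> = \<sigma> then 1 else 0) * (if j = v then 1 else 0) *
      (\<Sum>m < conj_multiplicity G X (T \<sigma>) \<alpha>.
         cnj (c \<sigma> u i \<alpha> m k) *
         (\<Sum>p < rep_dim G (T \<sigma>). \<Sum>r < rep_dim G (T \<sigma>).
            c \<sigma> p r \<alpha> m l * mat_elem (T \<sigma>) (b \<sigma>) p r g\<^sub>0))"
proof -
  interpret compact_group_haar G X \<mu> by fact
  note T = assms(3) and b = assms(4) and \<alpha> = assms(7) and \<sigma> = assms(8) and \<gamma> = assms(9)
    and k = assms(10) and l = assms(11) and i = assms(12) and j = assms(13) and u = assms(14) and v = assms(15)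
  have uni: "unitary_rep G X (T \<rho>)" if "\<rho> \<in> unitary_dual G X" for \<rho>
    using unitary_dual_irreducible[OF that T[OF that]] by (rule irreducible_rep_unitary)
  let ?n = "rep_dim G (T \<sigma>)"
  let ?t = "mat_elem (T \<sigma>) (b \<sigma>)"
  let ?a = "\<lambda>q. LINT x|\<mu>. cnj (mat_elem (T \<alpha>) (b \<alpha>) k l x) * ?t q i (x \<otimes>\<^bsub>G\<^esub> g\<^sub>0 \<otimes>\<^bsub>G\<^esub> inv\<^bsub>G\<^esub> x)"
  have n: "?n > 0" using i by simp
  have "L2_inner \<mu>
        (weighted_class_op G \<mu> (\<lambda>x. cnj (mat_elem (T \<alpha>) (b \<alpha>) k l x)) g\<^sub>0 (\<lambda>x. cnj (?t i j x)))
        (\<lambda>x. cnj (mat_elem (T \<gamma>) (b \<gamma>) u v x))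
    = (\<Sum>q<?n. ?a q * L2_inner \<mu> (\<lambda>y. cnj (?t q j y)) (\<lambda>x. cnj (mat_elem (T \<gamma>) (b \<gamma>) u v x)))"
    using mat_elem_continuous[OF uni[OF \<alpha>] b[OF \<alpha>] k l] mat_elem_continuous[OF uni[OF \<gamma>] b[OF \<gamma>] u v]
    by (intro weighted_class_op_inner uni b \<sigma> continuous_intros assms(2) i j)
  \<comment> \<open>Conjugating both arguments conjugates the pairing, and the orthogonality
    constant is real.\<close>
  also have "\<dots> = (\<Sum>q<?n. if q = u then (if \<gamma> = \<sigma> \<and> j = v then ?a u / of_nat ?n else 0) else 0)"
    using unitary_dual_orthogonality[OF T b \<sigma> \<gamma> _ j u v]
    by (intro sum.cong refl) (auto simp: L2_inner_cnj)
  \<comment> \<open>If \<gamma> differs from \<sigma>, \<open>u\<close> may lie outside the range of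
    \<open>q\<close>, but then the value to be selected is 0 anyway.\<close>
  also have "\<dots> = (if \<gamma> = \<sigma> \<and> j = v then ?a u / of_nat ?n else 0)"
    using u by (auto simp: sum.delta)
  finally have inner: "of_nat ?n * L2_inner \<mu>
        (weighted_class_op G \<mu> (\<lambda>x. cnj (mat_elem (T \<alpha>) (b \<alpha>) k l x)) g\<^sub>0 (\<lambda>x. cnj (?t i j x)))
        (\<lambda>x. cnj (mat_elem (T \<gamma>) (b \<gamma>) u v x)) = (if \<gamma> = \<sigma> \<and> j = v then ?a u else 0)"
    using n by simp
  show ?thesis
  proof (cases "\<gamma> = \<sigma> \<and> j = v")
    case True
    then have u': "u < ?n" using u by simp
    \<comment> \<open>The weight is already conjugated, so it can be absorbed into the antilinear
      second argument.\<close>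
    have "?a u = L2_inner \<mu> (\<lambda>x. ?t u i (x \<otimes>\<^bsub>G\<^esub> g\<^sub>0 \<otimes>\<^bsub>G\<^esub> inv\<^bsub>G\<^esub> x)) (mat_elem (T \<alpha>) (b \<alpha>) k l)"
      unfolding L2_inner_def by (simp add: mult.commute)
    also note L2_inner_mat_elem_conjugate[OF T b assms(5)[OF \<sigma>] assms(6)[OF \<sigma>] \<sigma> \<alpha> assms(2) u' i k l]
    finally show ?thesis unfolding inner using True by simp
  next
    case False
    then show ?thesis unfolding inner by auto
  qed
qed

end
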